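(* Assume the standing and strengthened assumptions in the context, let $f\in AC^1(I)$, and suppose $f(x)=a_1\phi_1(x)+a_2\phi_2(x)+o(\phi_2(x))$ as $x\to x_0$ for some real $a_1,a_2$. (I) If $L[f(x)]=o\big(W(x)^2\phi_1(x)^{-2}\phi_2(x)^{-1}\big)$ as $x\to x_0$, then $$\Big(\frac{f(x)}{\phi_1(x)}\Big)'=a_2\Big(\frac{\phi_2(x)}{\phi_1(x)}\Big)'+o\Big(\Big(\frac{\phi_2(x)}{\phi_1(x)}\Big)'\Big),\qquad x\to x_0.\tag{$*$}$$ (II) If $L[f(x)]=O\big(W(x)^2\phi_1(x)^{-2}\phi_2(x)^{-1}\big)$ as $x\to x_0$, then $(f(x)/\phi_1(x))'=O\big((\phi_2(x)/\phi_1(x))'\big)$ as $x\to x_0$. If in addition $\phi:=\phi_2/\phi_1$ has $\phi'$ strictly one-signed on a left neighborhood of $x_0$ and either $x_0\in\mathbb{R}$ and $(x-x_0)\phi'(x)\asymp\phi(x)$, $(x-x_0)\phi''(x)\asymp\phi'(x)$ as $x\to x_0$, or $x_0=+\infty$ and $x\phi'(x)\asymp\phi(x)$, $x\phi''(x)\asymp\phi'(x)$ as $x\to+\infty$, then $( * )$ holds.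
   Context: Let $x_0\in\mathbb{R}\cup\{+\infty\}$, $T<x_0$, $I:=[T,x_0)$. Limits and $O,o$ relations as $x\to x_0$ are taken for $x\in I$, over points where the functions are defined. $g_1\asymp g_2$ means $g_1=O(g_2)$ and $g_2=O(g_1)$. For differentiable $g,h$, $W(g,h;x):=g(x)h'(x)-g'(x)h(x)$. Standing assumptions: $\phi_1,\phi_2\in C^1(I)$; $\phi_2(x)=o(\phi_1(x))$ as $x\to x_0$; $\phi_1(x)\ne0$, $\phi_2(x)\neq0$ on $I$; $W(x):=W(\phi_1,\phi_2;x)\ne0$ on $I$. Strengthened: $\phi_1,\phi_2\in AC^1(I)$ ($C^1$ with derivative absolutely continuous on compact subintervals of $I$). $L$ is the unique operator $L[u]=u''+a_1(x)u'+a_2(x)u$ with locally integrable coefficients and kernel $\mathrm{span}(\phi_1,\phi_2)$; equivalently $L[u]=\frac{W}{\phi_1}\big[\frac{\phi_1^2}{W}(u/\phi_1)'\big]'$ for $u\in AC^1(I)$. *)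

theory Defs
  imports "HOL-Analysis.Analysis" "HOL-Library.Landau_Symbols"
begin

definition Ival :: "real \<Rightarrow> ereal \<Rightarrow> real set" where
  "Ival T x0 = {x. T \<le> x \<and> ereal x < x0}"

definition to_x0 :: "ereal \<Rightarrow> real filter" where
  "to_x0 x0 = (if x0 = \<infinity> then at_top else at_left (real_of_ereal x0))"

definition abs_cont_on :: "real \<Rightarrow> real \<Rightarrow> (real \<Rightarrow> real) \<Rightarrow> bool" where
  "abs_cont_on a b g \<longleftrightarrow>
     (\<forall>e>0. \<exists>d>0. \<forall>(n::nat) (l::nat \<Rightarrow> real) (r::nat \<Rightarrow> real).
        (\<forall>i<n. a \<le> l i \<and> l i \<le> r i \<and> r i \<le> b) \<and>
        (\<forall>i<n. \<forall>j<n. i \<noteq> j \<longrightarrow> r i \<le> l j \<or> r j \<le> l i) \<and>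
        (\<Sum>i<n. r i - l i) < d
        \<longrightarrow> (\<Sum>i<n. \<bar>g (r i) - g (l i)\<bar>) < e)"

definition dI :: "real set \<Rightarrow> (real \<Rightarrow> real) \<Rightarrow> real \<Rightarrow> real" where
  "dI I g x = vector_derivative g (at x within I)"

definition d2I :: "real set \<Rightarrow> (real \<Rightarrow> real) \<Rightarrow> real \<Rightarrow> real" where
  "d2I I g x = vector_derivative (dI I g) (at x within I)"

definition twice_diff_at :: "real set \<Rightarrow> (real \<Rightarrow> real) \<Rightarrow> real \<Rightarrow> bool" where
  "twice_diff_at I g x \<longleftrightarrow> x \<in> I \<and> g differentiable (at x within I) \<and>
                           dI I g differentiable (at x within I)"

definition C1_on :: "real set \<Rightarrow> (real \<Rightarrow> real) \<Rightarrow> bool" where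
  "C1_on I g \<longleftrightarrow> (\<forall>x\<in>I. g differentiable (at x within I)) \<and> continuous_on I (dI I g)"

definition AC1_on :: "real set \<Rightarrow> (real \<Rightarrow> real) \<Rightarrow> bool" where
  "AC1_on I g \<longleftrightarrow> C1_on I g \<and> (\<forall>a b. a \<le> b \<and> {a..b} \<subseteq> I \<longrightarrow> abs_cont_on a b (dI I g))"

definition wronskian :: "real set \<Rightarrow> (real \<Rightarrow> real) \<Rightarrow> (real \<Rightarrow> real) \<Rightarrow> real \<Rightarrow> real" where
  "wronskian I g h x = g x * dI I h x - dI I g x * h x"

text \<open>The operator L[u] = u'' + a1 u' + a2 u with kernel span(phi1, phi2):
  a1 = -W'/W, a2 = (phi1' phi2'' - phi1'' phi2')/W, where W' = phi1 phi2'' - phi1'' phi2.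
  It is defined at the points where u, phi1, phi2 are twice differentiable.\<close>
definition Lop :: "real set \<Rightarrow> (real \<Rightarrow> real) \<Rightarrow> (real \<Rightarrow> real) \<Rightarrow> (real \<Rightarrow> real) \<Rightarrow> real \<Rightarrow> real" where
  "Lop I p1 p2 u x =
     (let W = wronskian I p1 p2 x;
          a1 = - (p1 x * d2I I p2 x - d2I I p1 x * p2 x) / W;
          a2 = (dI I p1 x * d2I I p2 x - d2I I p1 x * dI I p2 x) / W
      in d2I I u x + a1 * dI I u x + a2 * u x)"

definition Ldom :: "real set \<Rightarrow> (real \<Rightarrow> real) \<Rightarrow> (real \<Rightarrow> real) \<Rightarrow> (real \<Rightarrow> real) \<Rightarrow> real set" where
  "Ldom I p1 p2 u = {x. twice_diff_at I u x \<and> twice_diff_at I p1 x \<and> twice_diff_at I p2 x}"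

end

theory Submission
  imports Defs
begin

text \<open>
  Put \<open>\<phi> = p\<^sub>2/p\<^sub>1\<close> and \<open>w = (f/p\<^sub>1)'/\<phi>' - a\<^sub>2\<close>; the claim is \<open>w \<rightarrow> 0\<close>. Since \<open>w + a\<^sub>2\<close> is the
  quotient \<open>W(p\<^sub>1,f)/W(p\<^sub>1,p\<^sub>2)\<close>, we have \<open>w' = p\<^sub>1 L[f] / W\<close> almost everywhere, so the \<open>O\<close>-hypothesis on
  \<open>L[f]\<close> says precisely that \<open>\<bar>w'\<bar> \<le> C \<bar>\<phi>'/\<phi>\<bar>\<close>: over a stretch on which \<open>\<bar>\<phi>\<bar>\<close> shrinks by a factor
  \<open>exp (-\<tau>)\<close>, the function \<open>w\<close> varies by at most \<open>C \<tau>\<close>. On the other hand \<open>k = f/p\<^sub>1 - a\<^sub>1 - a\<^sub>2 \<phi>\<close> is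
  \<open>o(\<phi>)\<close> and \<open>k' = w \<phi>'\<close>, so by Cauchy's mean value theorem \<open>w\<close> is small somewhere on each such
  stretch. Letting \<open>\<tau>\<close> be small gives \<open>w \<rightarrow> 0\<close>, a Tauberian argument in the style
  of Landau. An \<open>o\<close>-bound on \<open>L[f]\<close> being in particular an \<open>O\<close>-bound, this settles (I) and (II) at once.

  The measure-theoretic input is that an absolutely continuous function is differentiable almost
  everywhere and that its increments are controlled by its derivative there.
\<close>

subsection \<open>Absolutely continuous functions\<close>

lemma abs_cont_on_natD:
  assumes "abs_cont_on a b g" and "e > 0"
  obtains d where "d > 0" "\<And>(n::nat) l r.
        \<lbrakk>\<forall>i<n. a \<le> l i \<and> l i \<le> r i \<and> r i \<le> b;
         \<forall>i<n. \<forall>j<n. i \<noteq> j \<longrightarrow> r i \<le> l j \<or> r j \<le> l i; (\<Sum>i<n. r i - l i) < d\<rbrakk>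
        \<Longrightarrow> (\<Sum>i<n. \<bar>g (r i) - g (l i)\<bar>) < e"
proof -
  obtain d where "d > 0" and d: "\<forall>(n::nat) l r.
        (\<forall>i<n. a \<le> l i \<and> l i \<le> r i \<and> r i \<le> b) \<and>
         (\<forall>i<n. \<forall>j<n. i \<noteq> j \<longrightarrow> r i \<le> l j \<or> r j \<le> l i) \<and> (\<Sum>i<n. r i - l i) < d
        \<longrightarrow> (\<Sum>i<n. \<bar>g (r i) - g (l i)\<bar>) < e"
    using assms(1)[unfolded abs_cont_on_def, THEN spec, THEN mp, OF assms(2)] by (elim exE conjE)
  show thesis
    by (rule that[OF \<open>d > 0\<close>]) (rule d[THEN spec, THEN spec, THEN spec, THEN mp], intro conjI)
qed

text \<open>Vitali families and tagged divisions are indexed by sets, so absolute continuity is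
  transferred from numbered families to arbitrary finite index sets, with nonoverlap expressed
  through disjoint open intervals.\<close>

lemma abs_cont_onD:
  fixes g :: "real \<Rightarrow> real"
  assumes "abs_cont_on a b g" and "e > 0"
  obtains d where "d > 0"
    "\<And>(A :: 'i set) lo hi. \<lbrakk>finite A; \<And>i. i \<in> A \<Longrightarrow> a \<le> lo i \<and> lo i \<le> hi i \<and> hi i \<le> b;
       pairwise (\<lambda>i j. {lo i<..<hi i} \<inter> {lo j<..<hi j} = {}) A;
       (\<Sum>i\<in>A. hi i - lo i) < d\<rbrakk> \<Longrightarrow> (\<Sum>i\<in>A. \<bar>g (hi i) - g (lo i)\<bar>) < e"
proof -
  note AC = abs_cont_on_natD[OF assms]
  obtain d where "d > 0" and d: "\<And>(n::nat) l r.
        \<lbrakk>\<forall>i<n. a \<le> l i \<and> l i \<le> r i \<and> r i \<le> b;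
         \<forall>i<n. \<forall>j<n. i \<noteq> j \<longrightarrow> r i \<le> l j \<or> r j \<le> l i; (\<Sum>i<n. r i - l i) < d\<rbrakk>
        \<Longrightarrow> (\<Sum>i<n. \<bar>g (r i) - g (l i)\<bar>) < e"
    by (rule AC) blast
  show thesis
  proof (rule that[OF \<open>d > 0\<close>])
    fix A :: "'i set" and lo hi
    assume fin: "finite A" and bnd: "\<And>i. i \<in> A \<Longrightarrow> a \<le> lo i \<and> lo i \<le> hi i \<and> hi i \<le> b"
      and disj: "pairwise (\<lambda>i j. {lo i<..<hi i} \<inter> {lo j<..<hi j} = {}) A"
      and len: "(\<Sum>i\<in>A. hi i - lo i) < d"
    \<comment> \<open>Degenerate intervals may lie inside others, so they have to be dropped first.\<close>
    define B where "B = {i\<in>A. lo i < hi i}"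
    have B: "finite B" "B \<subseteq> A" using fin by (auto simp: B_def)
    obtain p where p: "bij_betw p {..<card B} B"
      using ex_bij_betw_nat_finite[OF B(1)] by (auto simp: atLeast0LessThan)
    have ord: "hi i \<le> lo j \<or> hi j \<le> lo i" if "i \<in> B" "j \<in> B" "i \<noteq> j" for i j
    proof (rule ccontr)
      assume "\<not> ?thesis"
      then have "max (lo i) (lo j) < min (hi i) (hi j)" using that by (auto simp: B_def)
      then obtain z where "max (lo i) (lo j) < z" "z < min (hi i) (hi j)" using dense by blast
      then have "z \<in> {lo i<..<hi i} \<inter> {lo j<..<hi j}" by auto
      with disj that B(2) show False unfolding pairwise_def by blast
    qed
    have "(\<Sum>i\<in>A. hi i - lo i) = (\<Sum>i\<in>B. hi i - lo i)"
      using fin bnd by (intro sum.mono_neutral_right) (force simp: B_def)+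
    also have "\<dots> = (\<Sum>i<card B. hi (p i) - lo (p i))"
      by (rule sum.reindex_bij_betw[OF p, symmetric])
    finally have len': "(\<Sum>i<card B. hi (p i) - lo (p i)) < d" using len by simp
    have "(\<Sum>i\<in>A. \<bar>g (hi i) - g (lo i)\<bar>) = (\<Sum>i\<in>B. \<bar>g (hi i) - g (lo i)\<bar>)"
    proof (intro sum.mono_neutral_right fin B ballI)
      fix i assume "i \<in> A - B"
      then have "hi i = lo i" using bnd[of i] by (force simp: B_def)
      then show "\<bar>g (hi i) - g (lo i)\<bar> = 0" by simp
    qed
    also have "\<dots> = (\<Sum>i<card B. \<bar>g (hi (p i)) - g (lo (p i))\<bar>)"
      by (rule sum.reindex_bij_betw[OF p, symmetric])
    also have "\<dots> < e"
    proof (rule d[OF _ _ len'])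
      show "\<forall>i<card B. a \<le> lo (p i) \<and> lo (p i) \<le> hi (p i) \<and> hi (p i) \<le> b"
        using bnd bij_betwE[OF p] B(2) by blast
      show "\<forall>i<card B. \<forall>j<card B. i \<noteq> j \<longrightarrow> hi (p i) \<le> lo (p j) \<or> hi (p j) \<le> lo (p i)"
        using ord bij_betwE[OF p] p by (metis bij_betw_imp_inj_on inj_on_eq_iff lessThan_iff)
    qed
    finally show "(\<Sum>i\<in>A. \<bar>g (hi i) - g (lo i)\<bar>) < e" .
  qed
qed

text \<open>One domination principle behind the closure properties: for differences, products and
  reciprocals it suffices to bound increments by those of known absolutely continuous
  functions.\<close>

lemma abs_cont_on_combine2:
  fixes g h k :: "real \<Rightarrow> real"
  assumes g: "abs_cont_on a b g" and h: "abs_cont_on a b h" 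
    and k: "\<And>x y. \<lbrakk>x \<in> {a..b}; y \<in> {a..b}\<rbrakk> \<Longrightarrow> \<bar>k y - k x\<bar> \<le> M * (\<bar>g y - g x\<bar> + \<bar>h y - h x\<bar>)"
  shows "abs_cont_on a b k"
  unfolding abs_cont_on_def
proof (intro allI impI)
  fix e :: real assume "e > 0"
  \<comment> \<open>\<open>M\<close> may be zero or negative; the strictly positive \<open>N\<close>
    makes \<open>e / (2 * N)\<close> a legitimate tolerance.\<close>
  define N where "N = \<bar>M\<bar> + 1"
  have N: "N > 0" "M \<le> N" by (auto simp: N_def)
  have eN: "e / (2 * N) > 0" using N(1) \<open>e > 0\<close> by simp
  obtain d1 where d1: "d1 > 0" "\<And>(n::nat) l r.
        \<lbrakk>\<forall>i<n. a \<le> l i \<and> l i \<le> r i \<and> r i \<le> b;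
         \<forall>i<n. \<forall>j<n. i \<noteq> j \<longrightarrow> r i \<le> l j \<or> r j \<le> l i; (\<Sum>i<n. r i - l i) < d1\<rbrakk>
        \<Longrightarrow> (\<Sum>i<n. \<bar>g (r i) - g (l i)\<bar>) < e / (2 * N)"
    by (rule abs_cont_on_natD[OF g eN]) blast
  obtain d2 where d2: "d2 > 0" "\<And>(n::nat) l r.
        \<lbrakk>\<forall>i<n. a \<le> l i \<and> l i \<le> r i \<and> r i \<le> b;
         \<forall>i<n. \<forall>j<n. i \<noteq> j \<longrightarrow> r i \<le> l j \<or> r j \<le> l i; (\<Sum>i<n. r i - l i) < d2\<rbrakk>
        \<Longrightarrow> (\<Sum>i<n. \<bar>h (r i) - h (l i)\<bar>) < e / (2 * N)"
    by (rule abs_cont_on_natD[OF h eN]) blast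
  show "\<exists>d>0. \<forall>(n::nat) l r. (\<forall>i<n. a \<le> l i \<and> l i \<le> r i \<and> r i \<le> b) \<and>
         (\<forall>i<n. \<forall>j<n. i \<noteq> j \<longrightarrow> r i \<le> l j \<or> r j \<le> l i) \<and> (\<Sum>i<n. r i - l i) < d
        \<longrightarrow> (\<Sum>i<n. \<bar>k (r i) - k (l i)\<bar>) < e"
  proof (intro exI[of _ "min d1 d2"] conjI allI impI)
    fix n :: nat and l r :: "nat \<Rightarrow> real"
    assume A: "(\<forall>i<n. a \<le> l i \<and> l i \<le> r i \<and> r i \<le> b) \<and>
         (\<forall>i<n. \<forall>j<n. i \<noteq> j \<longrightarrow> r i \<le> l j \<or> r j \<le> l i) \<and> (\<Sum>i<n. r i - l i) < min d1 d2"
    have "(\<Sum>i<n. \<bar>k (r i) - k (l i)\<bar>) \<le> (\<Sum>i<n. N * (\<bar>g (r i) - g (l i)\<bar> + \<bar>h (r i) - h (l i)\<bar>))"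
    proof (rule sum_mono)
      fix i assume "i \<in> {..<n}"
      then have "l i \<in> {a..b}" "r i \<in> {a..b}" using A by fastforce+
      from k[OF this] show "\<bar>k (r i) - k (l i)\<bar> \<le> N * (\<bar>g (r i) - g (l i)\<bar> + \<bar>h (r i) - h (l i)\<bar>)"
        using mult_right_mono[OF N(2), of "\<bar>g (r i) - g (l i)\<bar> + \<bar>h (r i) - h (l i)\<bar>"] by linarith
    qed
    also have "\<dots> = N * ((\<Sum>i<n. \<bar>g (r i) - g (l i)\<bar>) + (\<Sum>i<n. \<bar>h (r i) - h (l i)\<bar>))"
      by (simp add: sum_distrib_left sum.distrib distrib_left)
    also have "\<dots> < N * (e / (2 * N) + e / (2 * N))"
      using d1(2)[of n l r] d2(2)[of n l r] A N(1) by (intro mult_strict_left_mono add_strict_mono) auto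
    also have "\<dots> = e" using N(1) by (simp add: field_simps)
    finally show "(\<Sum>i<n. \<bar>k (r i) - k (l i)\<bar>) < e" .
  qed (use d1(1) d2(1) in auto)
qed

lemma abs_cont_on_combine:
  assumes "abs_cont_on a b g" 
    and "\<And>x y. \<lbrakk>x \<in> {a..b}; y \<in> {a..b}\<rbrakk> \<Longrightarrow> \<bar>k y - k x\<bar> \<le> M * \<bar>g y - g x\<bar>"
  shows "abs_cont_on a b k"
  \<comment> \<open>\<open>g\<close> fills both slots of the two-function bound, so each slot
    receives half of the constant.\<close>
  using assms(2) by (intro abs_cont_on_combine2[OF assms(1,1), where M = "M / 2"]) auto

lemma abs_cont_on_id: "abs_cont_on a b (\<lambda>x. x)"
  unfolding abs_cont_on_def
proof (intro allI impI)
  fix e :: real assume "e > 0"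
  have "(\<Sum>i<n. \<bar>r i - l i\<bar>) = (\<Sum>i<n. r i - l i)" if "\<forall>i<n. a \<le> l i \<and> l i \<le> r i \<and> r i \<le> b"
    for n :: nat and l r :: "nat \<Rightarrow> real"
    using that by (intro sum.cong) auto
  then show "\<exists>d>0. \<forall>n l r. (\<forall>i<n::nat. a \<le> l i \<and> l i \<le> r i \<and> r i \<le> b) \<and>
         (\<forall>i<n. \<forall>j<n. i \<noteq> j \<longrightarrow> r i \<le> l j \<or> r j \<le> l i) \<and> (\<Sum>i<n. r i - l i) < d \<longrightarrow>
         (\<Sum>i<n. \<bar>r i - l i\<bar>) < e"
    using \<open>e > 0\<close> by (intro exI[of _ e]) auto
qed

lemma abs_cont_on_diff:
  assumes "abs_cont_on a b g" "abs_cont_on a b h"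
  shows "abs_cont_on a b (\<lambda>x. g x - h x)"
  by (rule abs_cont_on_combine2[OF assms, where M = 1]) simp

lemma abs_cont_on_cmult:
  assumes "abs_cont_on a b g"
  shows "abs_cont_on a b (\<lambda>x. c * g x)"
  by (rule abs_cont_on_combine[OF assms, where M = "\<bar>c\<bar>"])
     (simp flip: right_diff_distrib abs_mult)

lemma abs_cont_on_mult:
  assumes g: "abs_cont_on a b g" "continuous_on {a..b} g"
    and h: "abs_cont_on a b h" "continuous_on {a..b} h"
  shows "abs_cont_on a b (\<lambda>x. g x * h x)"
proof -
  have "bounded (g ` {a..b})" "bounded (h ` {a..b})"
    using g h by (auto intro!: compact_imp_bounded compact_continuous_image)
  then obtain A B where A: "\<And>x. x \<in> {a..b} \<Longrightarrow> \<bar>g x\<bar> \<le> A" and B: "\<And>x. x \<in> {a..b} \<Longrightarrow> \<bar>h x\<bar> \<le> B"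
    unfolding bounded_iff by (metis imageI real_norm_def)
  show ?thesis
  proof (rule abs_cont_on_combine2[OF g(1) h(1)])
    fix x y assume xy: "x \<in> {a..b}" "y \<in> {a..b}"
    have "\<bar>g y * h y - g x * h x\<bar> = \<bar>h y * (g y - g x) + g x * (h y - h x)\<bar>"
      by (simp add: algebra_simps)
    also have "\<dots> \<le> \<bar>h y\<bar> * \<bar>g y - g x\<bar> + \<bar>g x\<bar> * \<bar>h y - h x\<bar>"
      by (metis abs_mult abs_triangle_ineq)
    also have "\<dots> \<le> (A + B) * \<bar>g y - g x\<bar> + (A + B) * \<bar>h y - h x\<bar>"
      using A[OF xy(1)] B[OF xy(2)] by (intro add_mono mult_right_mono) auto
    finally show "\<bar>g y * h y - g x * h x\<bar> \<le> (A + B) * (\<bar>g y - g x\<bar> + \<bar>h y - h x\<bar>)"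
      by (simp add: distrib_left)
  qed
qed

lemma abs_cont_on_inverse:
  assumes g: "abs_cont_on a b g" "continuous_on {a..b} g" and nz: "\<And>x. x \<in> {a..b} \<Longrightarrow> g x \<noteq> 0"
  shows "abs_cont_on a b (\<lambda>x. inverse (g x))"
proof -
  have "bounded ((\<lambda>x. inverse (g x)) ` {a..b})"
    using g nz by (auto intro!: compact_imp_bounded compact_continuous_image continuous_on_inverse)
  then obtain A where A: "\<And>x. x \<in> {a..b} \<Longrightarrow> \<bar>inverse (g x)\<bar> \<le> A"
    unfolding bounded_iff by (metis imageI real_norm_def)
  show ?thesis
  proof (rule abs_cont_on_combine[OF g(1)])
    fix x y assume xy: "x \<in> {a..b}" "y \<in> {a..b}"
    have "\<bar>inverse (g y) - inverse (g x)\<bar> = \<bar>inverse (g x)\<bar> * \<bar>inverse (g y)\<bar> * \<bar>g y - g x\<bar>"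
      using nz[OF xy(1)] nz[OF xy(2)] 
      by (simp add: inverse_diff_inverse abs_mult abs_minus_commute)
    also have "\<dots> \<le> (A * A) * \<bar>g y - g x\<bar>"
      using A[OF xy(1)] A[OF xy(2)] order_trans[OF abs_ge_zero A[OF xy(1)]]
      by (intro mult_right_mono mult_mono) auto
    finally show "\<bar>inverse (g y) - inverse (g x)\<bar> \<le> (A * A) * \<bar>g y - g x\<bar>" .
  qed
qed

subsection \<open>Vitali coverings by intervals\<close>

text \<open>An interval is encoded as the pair of its endpoints and read as a closed ball around its
  midpoint, the form in which the Vitali covering theorem is applied. The covered point need not be
  the centre, so intervals with an endpoint at \<open>x\<close> are allowed.\<close>

lemma Vitali_intervals:
  fixes S :: "real set"
  assumes cov: "\<And>x d. \<lbrakk>x \<in> S; d > 0\<rbrakk> \<Longrightarrow> \<exists>l r. P l r \<and> l < r \<and> l \<le> x \<and> x \<le> r \<and> r - l < d"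
  obtains \<C> where "countable \<C>" "\<And>K. K \<in> \<C> \<Longrightarrow> \<exists>l r. l < r \<and> P l r \<and> K = {l..r}"
    "disjoint \<C>" "negligible (S - \<Union>\<C>)"
proof -
  have cb: "cball (((fst i) + (snd i)) / 2) ((snd i - fst i) / 2) = {fst i..snd i}" for i :: "real \<times> real"
    by (auto simp: cball_eq_atLeastAtMost field_simps)
  let ?K = "{i. fst i < snd i \<and> P (fst i) (snd i)}"
  obtain C where C: "countable C" "C \<subseteq> ?K"
    "pairwise (\<lambda>i j. disjnt (cball ((fst i + snd i) / 2) ((snd i - fst i) / 2))
                            (cball ((fst j + snd j) / 2) ((snd j - fst j) / 2))) C"
    "negligible (S - (\<Union>i\<in>C. cball ((fst i + snd i) / 2) ((snd i - fst i) / 2)))"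
  proof (rule Vitali_covering_theorem_cballs[of ?K "\<lambda>i. (snd i - fst i) / 2" S "\<lambda>i. (fst i + snd i) / 2"])
    fix x d :: real assume "x \<in> S" "0 < d"
    from cov[OF this] obtain l r where "P l r \<and> l < r \<and> l \<le> x \<and> x \<le> r \<and> r - l < d" by blast
    then show "\<exists>i. i \<in> ?K \<and> x \<in> cball ((fst i + snd i) / 2) ((snd i - fst i) / 2) \<and> (snd i - fst i) / 2 < d"
      unfolding cb by (intro exI[of _ "(l, r)"]) auto
  qed auto
  show thesis
  proof (rule that[of "(\<lambda>i. {fst i..snd i}) ` C"])
    show "disjoint ((\<lambda>i. {fst i..snd i}) ` C)"
      using C(3) unfolding cb by (auto simp: pairwise_def disjnt_def)
  qed (use C in \<open>auto simp: cb\<close>)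
qed

text \<open>\<open>m\<close> is a lower bound for the outer measure of \<open>S\<close>, so
  \<open>S\<close> may be nonmeasurable. The countable Vitali family misses only a null part of
  \<open>S\<close>, hence its union has measure at least \<open>m\<close>; since \<open>U\<close>
  keeps that measure finite, a finite subfamily loses less than \<open>\<delta>\<close>.\<close>

lemma finite_Vitali_intervals:
  fixes S :: "real set"
  assumes cov: "\<And>x d. \<lbrakk>x \<in> S; d > 0\<rbrakk> \<Longrightarrow> \<exists>l r. P l r \<and> l < r \<and> l \<le> x \<and> x \<le> r \<and> r - l < d"
    and U: "U \<in> lmeasurable" "\<And>l r. \<lbrakk>P l r; l < r\<rbrakk> \<Longrightarrow> {l..r} \<subseteq> U"
    and m: "\<And>Z. \<lbrakk>Z \<in> lmeasurable; S \<subseteq> Z\<rbrakk> \<Longrightarrow> m \<le> measure lebesgue Z" and "\<delta> > 0"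
  obtains \<C> where "finite \<C>" "\<And>K. K \<in> \<C> \<Longrightarrow> \<exists>l r. l < r \<and> P l r \<and> K = {l..r}"
    "disjoint \<C>" "m - \<delta> < measure lebesgue (\<Union>\<C>)"
proof -
  obtain \<C> where C: "countable \<C>" "\<And>K. K \<in> \<C> \<Longrightarrow> \<exists>l r. l < r \<and> P l r \<and> K = {l..r}"
    "disjoint \<C>" "negligible (S - \<Union>\<C>)"
    using Vitali_intervals[of S P] cov by metis
  have lm: "K \<in> lmeasurable" if "K \<in> \<C>" for K using C(2)[OF that] by auto
  have sub: "\<Union>\<C> \<subseteq> U" using C(2) U(2) by fastforce
  have lmU: "\<Union>\<C> \<in> lmeasurable"
    using sub U(1) C(1) lm by (auto intro!: fmeasurableI2[OF U(1)] sets.countable_Union)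
  \<comment> \<open>Adding the null remainder turns the union into a measurable superset of
    \<open>S\<close> of the same measure.\<close>
  have "m \<le> measure lebesgue (\<Union>\<C> \<union> (S - \<Union>\<C>))"
    using lmU C(4) by (intro m fmeasurable.Un) (auto simp: negligible_imp_measurable)
  also have "\<dots> = measure lebesgue (\<Union>\<C>)"
    using C(4) lmU by (intro measure_Un_null_set) (auto simp: negligible_iff_null_sets)
  finally have mU: "m \<le> measure lebesgue (\<Union>\<C>)" .
  obtain D where D: "D \<subseteq> \<C>" "finite D" "measure lebesgue (\<Union>\<C>) - \<delta> < measure lebesgue (\<Union>D)"
  proof (rule measure_countable_Union_approachable[OF C(1) \<open>\<delta> > 0\<close> lm])
    fix D assume "D \<subseteq> \<C>" "finite D"
    then show "measure lebesgue (\<Union>D) \<le> measure lebesgue U"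
      using sub U(1) lm by (intro measure_mono_fmeasurable) (auto intro!: sets.finite_Union)
  qed auto
  show thesis
    using D C mU by (intro that[of D]) (auto intro: pairwise_subset)
qed

lemma division_telescope:
  fixes f :: "real \<Rightarrow> real"
  assumes "a \<le> b" and q: "q division_of {a..b}"
  shows "(\<Sum>K\<in>q. f (Sup K) - f (Inf K)) = f b - f a"
proof -
  \<comment> \<open>The left endpoint lies in its cell because cells of a division are nonempty
    closed intervals; with these tags the telescoping sum for tagged divisions applies.\<close>
  have tag: "(\<lambda>K. (Inf K, K)) ` q tagged_division_of {a..b}"
    unfolding tagged_division_of
  proof (intro conjI allI impI)
    fix x K assume "(x, K) \<in> (\<lambda>K. (Inf K, K)) ` q"
    then have K: "K \<in> q" "x = Inf K" by auto
    obtain l r where lr: "K = {l..r}" using division_ofD(4)[OF q K(1)] by auto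
    moreover have "K \<noteq> {}" using division_ofD(3)[OF q K(1)] .
    ultimately show "x \<in> K" using K by auto
    show "K \<subseteq> {a..b}" using division_ofD(2)[OF q K(1)] .
    show "\<exists>l r. K = cbox l r" using lr by auto
  next
    fix x1 K1 x2 K2
    assume "(x1, K1) \<in> (\<lambda>K. (Inf K, K)) ` q \<and> (x2, K2) \<in> (\<lambda>K. (Inf K, K)) ` q \<and> (x1, K1) \<noteq> (x2, K2)"
    then show "interior K1 \<inter> interior K2 = {}" using division_ofD(5)[OF q] by blast
  next
    show "finite ((\<lambda>K. (Inf K, K)) ` q)" using division_ofD(1)[OF q] by simp
    show "\<Union> {K. \<exists>x. (x, K) \<in> (\<lambda>K. (Inf K, K)) ` q} = {a..b}"
      using division_ofD(6)[OF q] by (simp add: image_iff)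
  qed
  have "(\<Sum>K\<in>q. f (Sup K) - f (Inf K)) = (\<Sum>(x, K)\<in>(\<lambda>K. (Inf K, K)) ` q. f (Sup K) - f (Inf K))"
    by (subst sum.reindex) (auto simp: inj_on_def)
  also have "\<dots> = f b - f a"
    by (rule additive_tagged_division_1[OF \<open>a \<le> b\<close> tag])
  finally show ?thesis .
qed

text \<open>\<open>m\<close> is the outer Lebesgue measure of \<open>E\<close>, the infimum over
  measurable supersets. It is positive because a set with arbitrarily small measurable supersets is
  negligible; outer regularity supplies the open sets.\<close>

lemma non_negligible_outer:
  assumes "\<not> negligible E" and E: "E \<subseteq> {a<..<b :: real}"
  obtains m where "m > 0" "\<And>Z. \<lbrakk>Z \<in> lmeasurable; E \<subseteq> Z\<rbrakk> \<Longrightarrow> m \<le> measure lebesgue Z"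
    "\<And>\<delta>. \<delta> > 0 \<Longrightarrow> \<exists>U. open U \<and> E \<subseteq> U \<and> U \<subseteq> {a<..<b} \<and> measure lebesgue U < m + \<delta>"
proof -
  define M where "M = measure lebesgue ` {Z. Z \<in> lmeasurable \<and> E \<subseteq> Z}"
  have bdd: "bdd_below M" unfolding M_def by (rule bdd_belowI[of _ 0]) auto
  have ne: "M \<noteq> {}" using E by (auto simp: M_def intro!: exI[of _ "{a<..<b}"])
  obtain e where e: "e > 0" "\<And>Z. \<lbrakk>Z \<in> lmeasurable; E \<subseteq> Z\<rbrakk> \<Longrightarrow> e \<le> measure lebesgue Z"
    using assms(1) unfolding negligible_outer by (meson not_less)
  show thesis
  proof (rule that[of "Inf M"])
    have "e \<le> Inf M" using e(2) by (intro cInf_greatest ne) (auto simp: M_def)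
    then show "Inf M > 0" using e(1) by simp
    show "Inf M \<le> measure lebesgue Z" if "Z \<in> lmeasurable" "E \<subseteq> Z" for Z
      using that by (intro cInf_lower bdd) (auto simp: M_def)
    fix \<delta> :: real assume "\<delta> > 0"
    \<comment> \<open>Half of \<open>\<delta>\<close> pays for the measurable superset, the other
      half for enlarging it to an open set.\<close>
    then obtain Z where Z: "Z \<in> lmeasurable" "E \<subseteq> Z" "measure lebesgue Z < Inf M + \<delta> / 2"
      using cInf_lessD[OF ne, of "Inf M + \<delta> / 2"] by (auto simp: M_def)
    obtain T where T: "open T" "Z \<subseteq> T" "T - Z \<in> lmeasurable" "emeasure lebesgue (T - Z) < ennreal (\<delta> / 2)"
      using sets_lebesgue_outer_open[of Z "\<delta> / 2"] Z(1) \<open>\<delta> > 0\<close> by (metis fmeasurableD half_gt_zero)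
    have "measure lebesgue (T - Z) < \<delta> / 2"
      using T(3,4) \<open>\<delta> > 0\<close> by (metis emeasure_eq_measure2 ennreal_less_iff measure_nonneg)
    moreover have "measure lebesgue (T \<inter> {a<..<b}) \<le> measure lebesgue (Z \<union> (T - Z))"
      using Z(1) T(1,3) by (intro measure_mono_fmeasurable fmeasurable.Un) auto
    moreover have "measure lebesgue (Z \<union> (T - Z)) \<le> measure lebesgue Z + measure lebesgue (T - Z)"
      using Z(1) T(3) by (intro measure_Un_le) auto
    ultimately have "measure lebesgue (T \<inter> {a<..<b}) < Inf M + \<delta>" using Z(3) by linarith
    then show "\<exists>U. open U \<and> E \<subseteq> U \<and> U \<subseteq> {a<..<b} \<and> measure lebesgue U < Inf M + \<delta>"
      using T(1,2) Z(2) E by (intro exI[of _ "T \<inter> {a<..<b}"]) auto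
  qed
qed

subsection \<open>Differentiability almost everywhere\<close>

text \<open>Used to cut the part of an interval that chosen subintervals leave uncovered into
  finitely many cells, to which absolute continuity can be applied.\<close>

lemma interval_division_extend:
  fixes a b :: real
  assumes "finite \<K>" and K: "\<And>K. K \<in> \<K> \<Longrightarrow> \<exists>l r. l < r \<and> K = {l..r} \<and> K \<subseteq> {a..b}" and "disjoint \<K>"
  obtains q where "\<K> \<subseteq> q" "q division_of {a..b}"
proof -
  have "\<K> division_of \<Union>\<K>"
    unfolding division_of_def
  proof (intro conjI ballI impI)
    fix L assume "L \<in> \<K>"
    then obtain l r where "l < r" "L = {l..r}" using K by blast
    then show "L \<noteq> {}" "\<exists>l r. L = cbox l r" by auto
    show "L \<subseteq> \<Union>\<K>" using \<open>L \<in> \<K>\<close> by blast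
  next
    fix K1 K2 assume "K1 \<in> \<K>" "K2 \<in> \<K>" "K1 \<noteq> K2"
    then have "K1 \<inter> K2 = {}" using \<open>disjoint \<K>\<close> by (auto simp: pairwise_def disjnt_def)
    then show "interior K1 \<inter> interior K2 = {}" by (metis interior_Int interior_empty)
  qed (use \<open>finite \<K>\<close> in auto)
  moreover have "\<Union>\<K> \<subseteq> cbox a b" using K by fastforce
  ultimately show thesis
    using partial_division_extend_interval that by (metis box_real(2))
qed

lemma measure_disjoint_intervals:
  assumes "finite \<K>" "\<And>K. K \<in> \<K> \<Longrightarrow> \<exists>l r. l < r \<and> K = {l..r :: real}" "disjoint \<K>"
  shows "measure lebesgue (\<Union>\<K>) = (\<Sum>K\<in>\<K>. Sup K - Inf K)"
proof -
  have "measure lebesgue (\<Union>\<K>) = (\<Sum>K\<in>\<K>. measure lebesgue K)"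
    using assms 
    by (intro measure_negligible_finite_Union) (force simp: pairwise_def disjnt_def)+
  also have "\<dots> = (\<Sum>K\<in>\<K>. Sup K - Inf K)"
    using assms(2) by (intro sum.cong) force+
  finally show ?thesis .
qed

text \<open>
  Cover \<open>E\<close>, up to small measure, by disjoint intervals \<open>J\<close> with \<open>h\<close>-increment \<open>\<le> 0\<close>, and then \<open>E\<close> again by
  disjoint intervals \<open>K\<close> inside the \<open>J\<close>s with increment \<open>\<ge> c \<bar>K\<bar>\<close>. The part of the \<open>J\<close>s outside the \<open>K\<close>s has
  small measure, so by absolute continuity \<open>h\<close> varies little there. Hence the increments over the
  \<open>J\<close>s sum to about \<open>c \<bar>E\<bar>\<close> or more, although none is positive. Outer measure \<open>m\<close> replaces \<open>\<bar>E\<bar>\<close>, so that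
  no measurability of \<open>E\<close> is needed.
\<close>

lemma abs_cont_negligible_crossing:
  assumes ac: "abs_cont_on a b h" and "c > 0" and E: "E \<subseteq> {a<..<b}"
    and down: "\<And>x d. \<lbrakk>x \<in> E; d > 0\<rbrakk> \<Longrightarrow> \<exists>l r. l < r \<and> l \<le> x \<and> x \<le> r \<and> r - l < d \<and> h r - h l \<le> 0"
    and up: "\<And>x d. \<lbrakk>x \<in> E; d > 0\<rbrakk> \<Longrightarrow> \<exists>l r. l < r \<and> l \<le> x \<and> x \<le> r \<and> r - l < d \<and> h r - h l \<ge> c * (r - l)"
  shows "negligible E"
proof (rule ccontr)
  assume "\<not> negligible E"
  then obtain m where m: "m > 0" "\<And>Z. \<lbrakk>Z \<in> lmeasurable; E \<subseteq> Z\<rbrakk> \<Longrightarrow> m \<le> measure lebesgue Z"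
    "\<And>\<delta>. \<delta> > 0 \<Longrightarrow> \<exists>U. open U \<and> E \<subseteq> U \<and> U \<subseteq> {a<..<b} \<and> measure lebesgue U < m + \<delta>"
    using non_negligible_outer[OF _ E] by metis
  have "c * m / 2 > 0" using \<open>c > 0\<close> m(1) by simp
  \<comment> \<open>The leftover cells will be indexed by pairs of an interval \<open>J\<close> and
    a cell of its division, which fixes the index type.\<close>
  obtain d where d: "d > 0"
    "\<And>(A :: (real set \<times> real set) set) lo hi. \<lbrakk>finite A; \<And>i. i \<in> A \<Longrightarrow> a \<le> lo i \<and> lo i \<le> hi i \<and> hi i \<le> b;
       pairwise (\<lambda>i j. {lo i<..<hi i} \<inter> {lo j<..<hi j} = {}) A;
       (\<Sum>i\<in>A. hi i - lo i) < d\<rbrakk> \<Longrightarrow> (\<Sum>i\<in>A. \<bar>h (hi i) - h (lo i)\<bar>) < c * m / 2"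
    by (rule abs_cont_onD[OF ac \<open>c * m / 2 > 0\<close>]) blast
  \<comment> \<open>The \<open>J\<close>s will have total length below \<open>m + \<delta>\<close>
    and the \<open>K\<close>s above \<open>m - \<delta>\<close>, so the leftover is shorter than
    \<open>2 * \<delta>\<close>, hence than \<open>d\<close>. The bound \<open>m / 4\<close> keeps
    \<open>c * (m - \<delta>)\<close> at least \<open>c * (3 / 4 * m)\<close>, above the error
    \<open>c * m / 2\<close>.\<close>
  define \<delta> where "\<delta> = min (m / 4) (d / 2)"
  have \<delta>: "\<delta> > 0" "\<delta> \<le> m / 4" "2 * \<delta> \<le> d" using m(1) d(1) by (auto simp: \<delta>_def)
  obtain U where U: "open U" "E \<subseteq> U" "U \<subseteq> {a<..<b}" "measure lebesgue U < m + \<delta>"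
    using m(3)[OF \<delta>(1)] by blast
  have Ulm: "U \<in> lmeasurable"
    by (rule lmeasurable_open[OF bounded_subset[OF bounded_box[of a b, unfolded box_real(1)] U(3)] U(1)])

  have covJ: "\<exists>l r. ({l..r} \<subseteq> U \<and> h r - h l \<le> 0) \<and> l < r \<and> l \<le> x \<and> x \<le> r \<and> r - l < e"
    if "x \<in> E" "e > 0" for x e
  proof -
    obtain \<eta> where \<eta>: "\<eta> > 0" "ball x \<eta> \<subseteq> U" using U(1,2) \<open>x \<in> E\<close> by (meson openE subsetD)
    obtain l r where lr: "l < r \<and> l \<le> x \<and> x \<le> r \<and> r - l < min e \<eta> \<and> h r - h l \<le> 0"
      using down[OF \<open>x \<in> E\<close>, of "min e \<eta>"] \<open>e > 0\<close> \<eta>(1) by (metis min_less_iff_conj)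
    then have "{l..r} \<subseteq> ball x \<eta>" by (auto simp: dist_real_def)
    with \<eta>(2) have "{l..r} \<subseteq> U" by blast
    with lr show ?thesis by (intro exI[of _ l] exI[of _ r]) simp
  qed
  obtain \<J> where J: "countable \<J>" "\<And>K. K \<in> \<J> \<Longrightarrow> \<exists>l r. l < r \<and> ({l..r} \<subseteq> U \<and> h r - h l \<le> 0) \<and> K = {l..r}"
    "disjoint \<J>" "negligible (E - \<Union>\<J>)"
    by (rule Vitali_intervals[of E "\<lambda>l r. {l..r} \<subseteq> U \<and> h r - h l \<le> 0", OF covJ]) blast+

  \<comment> \<open>\<open>E1\<close> discards the points that the \<open>J\<close>s miss and those
    at endpoints of the \<open>J\<close>s, a null set. Every remaining point has a ball inside its
    \<open>J\<close>, so short intervals around it stay in a single \<open>J\<close>.\<close>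
  define E1 where "E1 = E \<inter> (\<Union>J\<in>\<J>. interior J)"
  have "negligible (J - interior J)" if "J \<in> \<J>" for J
  proof -
    obtain l r where "J = {l..r}" using J(2)[OF \<open>J \<in> \<J>\<close>] by blast
    then have "J - interior J \<subseteq> {l, r}" by auto
    then show ?thesis by (meson finite.emptyI finite.insertI finite_subset negligible_finite)
  qed
  then have "negligible ((E - \<Union>\<J>) \<union> (\<Union>J\<in>\<J>. J - interior J))"
    using J(1,4) by (intro negligible_Un negligible_countable_Union) auto
  then have neg: "negligible (E - E1)"
    by (rule negligible_subset) (auto simp: E1_def)

  have covK: "\<exists>l r. ((\<exists>J\<in>\<J>. {l..r} \<subseteq> J) \<and> h r - h l \<ge> c * (r - l)) \<and> l < r \<and> l \<le> x \<and> x \<le> r \<and> r - l < e"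
    if "x \<in> E1" "e > 0" for x e
  proof -
    obtain J where "J \<in> \<J>" "x \<in> interior J" "x \<in> E" using \<open>x \<in> E1\<close> by (auto simp: E1_def)
    then obtain \<eta> where \<eta>: "\<eta> > 0" "ball x \<eta> \<subseteq> J" by (meson mem_interior)
    obtain l r where lr: "l < r \<and> l \<le> x \<and> x \<le> r \<and> r - l < min e \<eta> \<and> h r - h l \<ge> c * (r - l)"
      using up[OF \<open>x \<in> E\<close>, of "min e \<eta>"] \<open>e > 0\<close> \<eta>(1) by (metis min_less_iff_conj)
    then have "{l..r} \<subseteq> ball x \<eta>" by (auto simp: dist_real_def)
    with \<eta>(2) have "{l..r} \<subseteq> J" by blast
    with lr \<open>J \<in> \<J>\<close> show ?thesis by (intro exI[of _ l] exI[of _ r]) auto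
  qed
  have JU: "J \<subseteq> U" if "J \<in> \<J>" for J using J(2)[OF that] by blast
  obtain \<K> where K: "finite \<K>"
    "\<And>K. K \<in> \<K> \<Longrightarrow> \<exists>l r. l < r \<and> ((\<exists>J\<in>\<J>. {l..r} \<subseteq> J) \<and> h r - h l \<ge> c * (r - l)) \<and> K = {l..r}"
    "disjoint \<K>" "m - \<delta> < measure lebesgue (\<Union>\<K>)"
  proof (rule finite_Vitali_intervals[of E1 "\<lambda>l r. (\<exists>J\<in>\<J>. {l..r} \<subseteq> J) \<and> h r - h l \<ge> c * (r - l)", OF covK Ulm])
    \<comment> \<open>A measurable superset of \<open>E1\<close> becomes one of \<open>E\<close> by
      adding a null set, so the lower bound \<open>m\<close> persists.\<close>
    fix Z assume Z: "Z \<in> lmeasurable" "E1 \<subseteq> Z"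
    have "m \<le> measure lebesgue (Z \<union> (E - E1))"
      using Z neg by (intro m(2) fmeasurable.Un) (auto simp: negligible_imp_measurable)
    also have "\<dots> = measure lebesgue Z"
      using Z(1) neg by (intro measure_Un_null_set) (auto simp: negligible_iff_null_sets)
    finally show "m \<le> measure lebesgue Z" .
  qed (use JU \<delta>(1) in \<open>blast+\<close>)

  \<comment> \<open>For the identity \<open>inc\<close> is length, for \<open>h\<close> it is the
    increment; the one identity \<open>split\<close> below serves both.\<close>
  define inc where "inc f K = f (Sup K) - f (Inf K)" for f :: "real \<Rightarrow> real" and K
  have "\<forall>K\<in>\<K>. \<exists>J\<in>\<J>. K \<subseteq> J" using K(2) by blast
  then obtain j where j: "\<And>K. K \<in> \<K> \<Longrightarrow> j K \<in> \<J> \<and> K \<subseteq> j K" by metis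
  \<comment> \<open>Only the finitely many \<open>J\<close>s that host some chosen \<open>K\<close>
    are kept.\<close>
  define \<J>' where "\<J>' = j ` \<K>"
  have J': "finite \<J>'" "\<J>' \<subseteq> \<J>" using K(1) j by (auto simp: \<J>'_def)
  have "\<exists>q. {K\<in>\<K>. j K = J} \<subseteq> q \<and> q division_of J" if "J \<in> \<J>'" for J
  proof -
    obtain l r where J_eq: "J = {l..r}" using J(2) J'(2) \<open>J \<in> \<J>'\<close> by blast
    have "\<exists>l' r'. l' < r' \<and> K = {l'..r'} \<and> K \<subseteq> {l..r}" if "K \<in> {K\<in>\<K>. j K = J}" for K
      using K(2)[of K] j[of K] that J_eq by auto
    moreover have "finite {K\<in>\<K>. j K = J}" "disjoint {K\<in>\<K>. j K = J}"
      using K(1) by (auto intro: pairwise_subset[OF K(3)])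
    ultimately obtain q where "{K\<in>\<K>. j K = J} \<subseteq> q" "q division_of {l..r}"
      using interval_division_extend[of "{K\<in>\<K>. j K = J}" l r] by blast
    then show ?thesis unfolding J_eq by blast
  qed
  then obtain q where q: "\<And>J. J \<in> \<J>' \<Longrightarrow> {K\<in>\<K>. j K = J} \<subseteq> q J \<and> q J division_of J" by metis
  define D where "D = Sigma \<J>' (\<lambda>J. q J - {K\<in>\<K>. j K = J})"
  have finq: "finite (q J)" if "J \<in> \<J>'" for J using q[OF that] by blast
  have split: "(\<Sum>J\<in>\<J>'. inc f J) = (\<Sum>K\<in>\<K>. inc f K) + (\<Sum>i\<in>D. inc f (snd i))" for f
  proof -
    have "inc f J = (\<Sum>K\<in>{K\<in>\<K>. j K = J}. inc f K) + (\<Sum>K\<in>q J - {K\<in>\<K>. j K = J}. inc f K)" if "J \<in> \<J>'" for J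
    proof -
      obtain l r where "l < r" "J = {l..r}" using J(2) J'(2) \<open>J \<in> \<J>'\<close> by blast
      then have "inc f J = (\<Sum>K\<in>q J. inc f K)"
        using division_telescope[of l r "q J" f] q[OF that] by (simp add: inc_def)
      also have "\<dots> = (\<Sum>K\<in>q J - {K\<in>\<K>. j K = J}. inc f K) + (\<Sum>K\<in>{K\<in>\<K>. j K = J}. inc f K)"
        using finq[OF that] q[OF that] by (intro sum.subset_diff) auto
      finally show ?thesis by simp
    qed
    then have "(\<Sum>J\<in>\<J>'. inc f J) = (\<Sum>J\<in>\<J>'. \<Sum>K\<in>{K\<in>\<K>. j K = J}. inc f K)
        + (\<Sum>J\<in>\<J>'. \<Sum>K\<in>q J - {K\<in>\<K>. j K = J}. inc f K)"
      by (simp add: sum.distrib)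
    also have "(\<Sum>J\<in>\<J>'. \<Sum>K\<in>{K\<in>\<K>. j K = J}. inc f K) = (\<Sum>K\<in>\<K>. inc f K)"
      unfolding \<J>'_def by (rule sum.image_gen[OF K(1), symmetric])
    also have "(\<Sum>J\<in>\<J>'. \<Sum>K\<in>q J - {K\<in>\<K>. j K = J}. inc f K) = (\<Sum>i\<in>D. inc f (snd i))"
      unfolding D_def using J'(1) finq by (subst sum.Sigma) (auto simp: case_prod_beta)
    finally show ?thesis .
  qed

  have lenK: "(\<Sum>K\<in>\<K>. inc (\<lambda>x. x) K) > m - \<delta>"
  proof -
    have "measure lebesgue (\<Union>\<K>) = (\<Sum>K\<in>\<K>. Sup K - Inf K)"
      by (rule measure_disjoint_intervals[OF K(1) _ K(3)]) (use K(2) in blast)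
    then show ?thesis using K(4) by (simp add: inc_def)
  qed
  have "\<exists>l r. l < r \<and> J = {l..r}" if "J \<in> \<J>'" for J
    using J(2)[of J] J'(2) that by blast
  then have "(\<Sum>J\<in>\<J>'. inc (\<lambda>x. x) J) = measure lebesgue (\<Union>\<J>')"
    unfolding inc_def
    by (rule measure_disjoint_intervals[OF J'(1) _ pairwise_subset[OF J(3) J'(2)], symmetric])
  also have "\<dots> \<le> measure lebesgue U"
  proof (rule measure_mono_fmeasurable)
    show "\<Union>\<J>' \<subseteq> U" using J'(2) JU by blast
    have "J \<in> sets lebesgue" if "J \<in> \<J>'" for J using J(2) J'(2) that by fastforce
    then show "\<Union>\<J>' \<in> sets lebesgue" using J'(1) by (intro sets.finite_Union) auto
  qed (rule Ulm)
  finally have "(\<Sum>J\<in>\<J>'. inc (\<lambda>x. x) J) < m + \<delta>" using U(4) by simp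
  then have lenD: "(\<Sum>i\<in>D. inc (\<lambda>x. x) (snd i)) < d" using split[of "\<lambda>x. x"] lenK \<delta>(3) by simp

  have Dq: "fst i \<in> \<J>'" "snd i \<in> q (fst i)" if "i \<in> D" for i using that by (auto simp: D_def)
  have bnd: "\<exists>l r. snd i = {l..r} \<and> l \<le> r \<and> {l..r} \<subseteq> fst i" if i: "i \<in> D" for i
  proof -
    have div: "q (fst i) division_of fst i" using q Dq[OF i] by blast
    obtain l r where "snd i = {l..r}" using division_ofD(4)[OF div Dq(2)[OF i]] by auto
    then show ?thesis using division_ofD(2,3)[OF div Dq(2)[OF i]] by auto
  qed
  have "(\<Sum>i\<in>D. \<bar>h (Sup (snd i)) - h (Inf (snd i))\<bar>) < c * m / 2"
  proof (rule d(2))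
    show "finite D" unfolding D_def using J'(1) finq by blast
    show "(\<Sum>i\<in>D. Sup (snd i) - Inf (snd i)) < d" using lenD by (simp add: inc_def)
    show "a \<le> Inf (snd i) \<and> Inf (snd i) \<le> Sup (snd i) \<and> Sup (snd i) \<le> b" if i: "i \<in> D" for i
    proof -
      obtain l r where lr: "snd i = {l..r}" "l \<le> r" "{l..r} \<subseteq> fst i" using bnd[OF i] by blast
      then have "{l..r} \<subseteq> {a<..<b}" using JU[of "fst i"] Dq(1)[OF i] J'(2) U(3) by blast
      then show ?thesis using lr by auto
    qed
    show "pairwise (\<lambda>i j. {Inf (snd i)<..<Sup (snd i)} \<inter> {Inf (snd j)<..<Sup (snd j)} = {}) D"
      unfolding pairwise_def
    proof (intro ballI impI)
      fix i i' assume i: "i \<in> D" "i' \<in> D" "i \<noteq> i'"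
      obtain l r where lr: "snd i = {l..r}" "l \<le> r" "{l..r} \<subseteq> fst i" using bnd[OF i(1)] by blast
      obtain l' r' where lr': "snd i' = {l'..r'}" "l' \<le> r'" "{l'..r'} \<subseteq> fst i'" using bnd[OF i(2)] by blast
      \<comment> \<open>Cells in the same \<open>J\<close> do not overlap because they belong to one
        division; cells in different \<open>J\<close>s are separated by the disjointness of the
        Vitali family.\<close>
      have "interior (snd i) \<inter> interior (snd i') = {}"
      proof (cases "fst i = fst i'")
        case True
        then have "snd i \<noteq> snd i'" using i(3) by (simp add: prod_eq_iff)
        then show ?thesis
          using division_ofD(5)[of "q (fst i)" "fst i"] q[OF Dq(1)[OF i(1)]] Dq(2)[OF i(1)] Dq(2)[OF i(2)] True
          by metis
      next
        case False
        then have "fst i \<inter> fst i' = {}"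
          using J(3) J'(2) Dq(1)[OF i(1)] Dq(1)[OF i(2)] by (auto simp: pairwise_def disjnt_def)
        then have "snd i \<inter> snd i' = {}" using lr lr' by blast
        then show ?thesis by (metis interior_Int interior_empty)
      qed
      then show "{Inf (snd i)<..<Sup (snd i)} \<inter> {Inf (snd i')<..<Sup (snd i')} = {}"
        using lr lr' by simp
    qed
  qed
  then have "(\<Sum>i\<in>D. \<bar>inc h (snd i)\<bar>) < c * m / 2" by (simp add: inc_def)
  \<comment> \<open>The leftover lowers the total increment by less than \<open>c * m / 2\<close>,
    while the \<open>K\<close>s contribute at least \<open>c * (3 / 4 * m)\<close>; the sum over the
    \<open>J\<close>s would then be positive.\<close>
  then have "(\<Sum>i\<in>D. inc h (snd i)) > - (c * m / 2)"
    using sum_abs[of "\<lambda>i. inc h (snd i)" D] by linarith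
  moreover have "c * (\<Sum>K\<in>\<K>. inc (\<lambda>x. x) K) \<le> (\<Sum>K\<in>\<K>. inc h K)"
    unfolding sum_distrib_left
  proof (rule sum_mono)
    fix K assume "K \<in> \<K>"
    from K(2)[OF this] show "c * inc (\<lambda>x. x) K \<le> inc h K" by (auto simp: inc_def)
  qed
  moreover have "c * (\<Sum>K\<in>\<K>. inc (\<lambda>x. x) K) \<ge> c * (3 / 4 * m)"
    using lenK \<delta>(2) \<open>c > 0\<close> by (intro mult_left_mono) auto
  moreover have "(\<Sum>J\<in>\<J>'. inc h J) \<le> 0"
  proof (rule sum_nonpos)
    fix J assume "J \<in> \<J>'"
    then have "J \<in> \<J>" using J'(2) by blast
    from J(2)[OF this] show "inc h J \<le> 0" by (auto simp: inc_def)
  qed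
  moreover have "c * m > 0" using \<open>c > 0\<close> m(1) by simp
  ultimately show False using split[of h] by simp
qed

text \<open>Inside a window shorter than \<open>d\<close>, disjoint intervals have increments
  summing to less than 1. If \<open>E\<close> had outer measure \<open>m > 0\<close> there, Vitali
  would give intervals of total length above \<open>m / 2\<close> and slope at least
  \<open>2 / m\<close> in absolute value, whose increments sum to at least 1.\<close>

lemma abs_cont_negligible_infinite:
  assumes ac: "abs_cont_on a b g" and E: "E \<subseteq> {a<..<b}"
    and inf: "\<And>x d n. \<lbrakk>x \<in> E; d > 0\<rbrakk> \<Longrightarrow> \<exists>l r. l < r \<and> l \<le> x \<and> x \<le> r \<and> r - l < d \<and> \<bar>g r - g l\<bar> \<ge> n * (r - l)"
  shows "negligible E"
proof -
  obtain d where d: "d > 0"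
    "\<And>(A :: real set set) lo hi. \<lbrakk>finite A; \<And>i. i \<in> A \<Longrightarrow> a \<le> lo i \<and> lo i \<le> hi i \<and> hi i \<le> b;
       pairwise (\<lambda>i j. {lo i<..<hi i} \<inter> {lo j<..<hi j} = {}) A;
       (\<Sum>i\<in>A. hi i - lo i) < d\<rbrakk> \<Longrightarrow> (\<Sum>i\<in>A. \<bar>g (hi i) - g (lo i)\<bar>) < 1"
    by (rule abs_cont_onD[OF ac zero_less_one]) blast
  have neg: "negligible (E \<inter> {t<..<t+d/2})" for t
  proof (rule ccontr)
    define E1 where "E1 = E \<inter> {t<..<t+d/2}"
    assume "\<not> negligible (E \<inter> {t<..<t+d/2})"
    then have nneg: "\<not> negligible E1" by (simp add: E1_def)
    define \<alpha> \<beta> where "\<alpha> = max a t" and "\<beta> = min b (t + d / 2)"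
    have "E1 \<subseteq> {\<alpha><..<\<beta>}" using E by (auto simp: E1_def \<alpha>_def \<beta>_def)
    then obtain m where m: "m > 0" "\<And>Z. \<lbrakk>Z \<in> lmeasurable; E1 \<subseteq> Z\<rbrakk> \<Longrightarrow> m \<le> measure lebesgue Z"
      using non_negligible_outer[OF nneg] by metis
    define n where "n = 2 / m"
    have cov: "\<exists>l r. ({l..r} \<subseteq> {\<alpha><..<\<beta>} \<and> \<bar>g r - g l\<bar> \<ge> n * (r - l)) \<and> l < r \<and> l \<le> x \<and> x \<le> r \<and> r - l < e"
      if "x \<in> E1" "e > 0" for x e
    proof -
      have "x \<in> {\<alpha><..<\<beta>}" using \<open>x \<in> E1\<close> \<open>E1 \<subseteq> _\<close> by blast
      then obtain \<eta> where \<eta>: "\<eta> > 0" "ball x \<eta> \<subseteq> {\<alpha><..<\<beta>}" by (meson openE open_greaterThanLessThan)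
      have "x \<in> E" using \<open>x \<in> E1\<close> by (simp add: E1_def)
      then obtain l r where lr: "l < r \<and> l \<le> x \<and> x \<le> r \<and> r - l < min e \<eta> \<and> \<bar>g r - g l\<bar> \<ge> n * (r - l)"
        using inf[of x "min e \<eta>"] \<open>e > 0\<close> \<eta>(1) by (metis min_less_iff_conj)
      then have "{l..r} \<subseteq> ball x \<eta>" by (auto simp: dist_real_def)
      with \<eta>(2) have "{l..r} \<subseteq> {\<alpha><..<\<beta>}" by blast
      with lr show ?thesis by (intro exI[of _ l] exI[of _ r]) simp
    qed
    obtain \<K> where K: "finite \<K>"
      "\<And>K. K \<in> \<K> \<Longrightarrow> \<exists>l r. l < r \<and> ({l..r} \<subseteq> {\<alpha><..<\<beta>} \<and> \<bar>g r - g l\<bar> \<ge> n * (r - l)) \<and> K = {l..r}"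
      "disjoint \<K>" "m - m / 2 < measure lebesgue (\<Union>\<K>)"
    proof (rule finite_Vitali_intervals[of E1 "\<lambda>l r. {l..r} \<subseteq> {\<alpha><..<\<beta>} \<and> \<bar>g r - g l\<bar> \<ge> n * (r - l)", OF cov])
      show "{\<alpha><..<\<beta>} \<in> lmeasurable" by simp
      show "m / 2 > 0" using m(1) by simp
    qed (use m(2) in blast)+
    have len: "measure lebesgue (\<Union>\<K>) = (\<Sum>K\<in>\<K>. Sup K - Inf K)"
      using K(2) by (intro measure_disjoint_intervals K) blast
    have sub: "\<Union>\<K> \<subseteq> {\<alpha><..<\<beta>}" using K(2) by blast
    have "\<alpha> < \<beta>" using nneg \<open>E1 \<subseteq> _\<close> by (cases "\<alpha> < \<beta>") auto
    have "K \<in> sets lebesgue" if "K \<in> \<K>" for K using K(2)[OF that] by auto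
    then have "measure lebesgue (\<Union>\<K>) \<le> measure lebesgue {\<alpha><..<\<beta>}"
      using K(1) by (intro measure_mono_fmeasurable[OF sub] sets.finite_Union) auto
    also have "\<dots> = \<beta> - \<alpha>" using \<open>\<alpha> < \<beta>\<close> by simp
    also have "\<dots> < d" using d(1) by (simp add: \<alpha>_def \<beta>_def)
    finally have len_d: "(\<Sum>K\<in>\<K>. Sup K - Inf K) < d" using len by simp
    have "(\<Sum>K\<in>\<K>. \<bar>g (Sup K) - g (Inf K)\<bar>) < 1"
    proof (rule d(2)[OF K(1) _ _ len_d])
      fix K assume "K \<in> \<K>"
      then obtain l r where lr: "l < r" "{l..r} \<subseteq> {\<alpha><..<\<beta>}" "K = {l..r}" using K(2) by blast
      then have "l \<in> {\<alpha><..<\<beta>}" "r \<in> {\<alpha><..<\<beta>}"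
        by (meson atLeastAtMost_iff less_imp_le order_refl subsetD)+
      then show "a \<le> Inf K \<and> Inf K \<le> Sup K \<and> Sup K \<le> b"
        using lr by (auto simp: \<alpha>_def \<beta>_def)
    next
      show "pairwise (\<lambda>K L. {Inf K<..<Sup K} \<inter> {Inf L<..<Sup L} = {}) \<K>"
        unfolding pairwise_def
      proof (intro ballI impI)
        fix K L assume KL: "K \<in> \<K>" "L \<in> \<K>" "K \<noteq> L"
        then have "K \<inter> L = {}" using K(3) by (auto simp: pairwise_def disjnt_def)
        moreover have "{Inf K<..<Sup K} \<subseteq> K" "{Inf L<..<Sup L} \<subseteq> L"
          using K(2)[OF KL(1)] K(2)[OF KL(2)] by auto
        ultimately show "{Inf K<..<Sup K} \<inter> {Inf L<..<Sup L} = {}" by blast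
      qed
    qed
    moreover have "n * (\<Sum>K\<in>\<K>. Sup K - Inf K) \<le> (\<Sum>K\<in>\<K>. \<bar>g (Sup K) - g (Inf K)\<bar>)"
      unfolding sum_distrib_left
    proof (rule sum_mono)
      fix K assume "K \<in> \<K>"
      from K(2)[OF this] show "n * (Sup K - Inf K) \<le> \<bar>g (Sup K) - g (Inf K)\<bar>" by auto
    qed
    moreover have "n * (m / 2) \<le> n * (\<Sum>K\<in>\<K>. Sup K - Inf K)"
      using K(4) len m(1) by (intro mult_left_mono) (auto simp: n_def)
    moreover have "n * (m / 2) = 1" using m(1) by (simp add: n_def)
    ultimately show False by linarith
  qed
  \<comment> \<open>Windows with rational left endpoints suffice to cover \<open>E\<close>, so
    countably many null sets are united.\<close>
  have "E \<subseteq> (\<Union>t\<in>\<rat>. E \<inter> {t<..<t+d/2})"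
  proof
    fix x assume "x \<in> E"
    obtain t where "t \<in> \<rat>" "x - d / 2 < t" "t < x"
      using Rats_dense_in_real[of "x - d / 2" x] d(1) by auto
    then show "x \<in> (\<Union>t\<in>\<rat>. E \<inter> {t<..<t+d/2})" using \<open>x \<in> E\<close> by force
  qed
  moreover have "negligible (\<Union>t\<in>\<rat>. E \<inter> {t<..<t+d/2})"
    using neg by (intro negligible_countable_Union) (auto simp: countable_rat)
  ultimately show ?thesis by (rule negligible_subset[rotated])
qed

text \<open>Where \<open>g\<close> is not differentiable, its difference quotients are either
  unbounded (\<open>E'\<close>) or bounded with distinct lower and upper limits, which two rationals
  \<open>r < s\<close> separate (\<open>E r s\<close>). Steep intervals make \<open>E'\<close> null,
  the crossing lemma makes each \<open>E r s\<close> null, and there are countably many rational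
  pairs.\<close>

lemma abs_cont_on_negligible_not_differentiable:
  assumes ac: "abs_cont_on a b g"
  shows "negligible {x\<in>{a<..<b}. \<not> g differentiable (at x)}"
proof -
  define Q where "Q x y = (g y - g x) / (y - x)" for x y
  define E where "E r s = {x\<in>{a<..<b}. (\<exists>\<^sub>F y in at x. Q x y < r) \<and> (\<exists>\<^sub>F y in at x. s < Q x y)}" for r s
  define E' where "E' = {x\<in>{a<..<b}. \<forall>n. \<exists>\<^sub>F y in at x. n < \<bar>Q x y\<bar>}"

  \<comment> \<open>The interval has endpoints \<open>x\<close> and a nearby \<open>y\<close>; the
    quotient is symmetric in the two, so \<open>min\<close> and \<open>max\<close> may order
    them.\<close>
  have freq: "\<exists>l r. l < r \<and> l \<le> x \<and> x \<le> r \<and> r - l < d \<and> P ((g r - g l) / (r - l))"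
    if "\<exists>\<^sub>F y in at x. P (Q x y)" "d > 0" for x d P
  proof -
    have "\<forall>\<^sub>F y in at x. y \<noteq> x \<and> dist y x < d"
      unfolding eventually_at using \<open>d > 0\<close> by blast
    then have "\<exists>\<^sub>F y in at x. P (Q x y) \<and> y \<noteq> x \<and> dist y x < d"
      by (rule frequently_eventually_frequently[OF that(1)])
    then obtain y where y: "P (Q x y)" "y \<noteq> x" "\<bar>y - x\<bar> < d"
      by (auto dest: frequently_ex simp: dist_real_def)
    have "Q x y = (g (max x y) - g (min x y)) / (max x y - min x y)"
      using y(2) by (cases "x < y") (auto simp: Q_def max_def min_def divide_simps algebra_simps)
    then show ?thesis using y by (intro exI[of _ "min x y"] exI[of _ "max x y"]) auto
  qed

  have "negligible (E r s)" if "r < s" for r s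
  \<comment> \<open>After tilting by slope \<open>r\<close>, a quotient below \<open>r\<close>
    becomes a nonpositive increment and a quotient above \<open>s\<close> a slope of at least
    \<open>s - r > 0\<close>.\<close>
  proof (rule abs_cont_negligible_crossing[where h = "\<lambda>x. g x - r * x" and c = "s - r"])
    show "abs_cont_on a b (\<lambda>x. g x - r * x)"
      by (intro abs_cont_on_diff ac abs_cont_on_cmult abs_cont_on_id)
    show "E r s \<subseteq> {a<..<b}" by (auto simp: E_def)
  next
    fix x d :: real assume x: "x \<in> E r s" "d > 0"
    obtain u v where uv: "u < v" "u \<le> x" "x \<le> v" "v - u < d" "(g v - g u) / (v - u) < r"
      using freq[where x=x and P="\<lambda>q. q < r", OF _ x(2)] x(1) unfolding E_def by blast
    then show "\<exists>l r'. l < r' \<and> l \<le> x \<and> x \<le> r' \<and> r' - l < d \<and> (g r' - r * r') - (g l - r * l) \<le> 0"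
      by (intro exI[of _ u] exI[of _ v]) (auto simp: divide_simps algebra_simps)
    obtain u v where uv: "u < v" "u \<le> x" "x \<le> v" "v - u < d" "s < (g v - g u) / (v - u)"
      using freq[where x=x and P="\<lambda>q. s < q", OF _ x(2)] x(1) unfolding E_def by blast
    then show "\<exists>l r'. l < r' \<and> l \<le> x \<and> x \<le> r' \<and> r' - l < d \<and>
        (s - r) * (r' - l) \<le> (g r' - r * r') - (g l - r * l)"
      by (intro exI[of _ u] exI[of _ v]) (auto simp: divide_simps algebra_simps)
  qed (use that in simp)
  moreover have "negligible E'"
  proof (rule abs_cont_negligible_infinite[OF ac])
    show "E' \<subseteq> {a<..<b}" by (auto simp: E'_def)
    fix x d n :: real assume x: "x \<in> E'" "d > 0"
    obtain u v where uv: "u < v" "u \<le> x" "x \<le> v" "v - u < d" "n < \<bar>(g v - g u) / (v - u)\<bar>"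
      using freq[where x=x and P="\<lambda>q. n < \<bar>q\<bar>", OF _ x(2)] x(1) unfolding E'_def by blast
    then show "\<exists>l r. l < r \<and> l \<le> x \<and> x \<le> r \<and> r - l < d \<and> n * (r - l) \<le> \<bar>g r - g l\<bar>"
      by (intro exI[of _ u] exI[of _ v]) (auto simp: pos_less_divide_eq)
  qed
  moreover have "{x\<in>{a<..<b}. \<not> g differentiable (at x)} \<subseteq> (\<Union>(r, s)\<in>{(r, s). r \<in> \<rat> \<and> s \<in> \<rat> \<and> r < s}. E r s) \<union> E'"
  proof (intro subsetI, rule ccontr)
    fix x assume x: "x \<in> {x\<in>{a<..<b}. \<not> g differentiable (at x)}"
      and nx: "x \<notin> (\<Union>(r, s)\<in>{(r, s). r \<in> \<rat> \<and> s \<in> \<rat> \<and> r < s}. E r s) \<union> E'"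
    obtain n where n: "\<forall>\<^sub>F y in at x. \<bar>Q x y\<bar> \<le> n"
      using nx x unfolding E'_def by (auto simp: frequently_def not_less)
    \<comment> \<open>Extended reals guarantee that both limits exist; \<open>bnd\<close> later
      rules out infinite values.\<close>
    define A B where "A = Liminf (at x) (\<lambda>y. ereal (Q x y))" and "B = Limsup (at x) (\<lambda>y. ereal (Q x y))"
    have bnd: "ereal (- n) \<le> A" "B \<le> ereal n" 
      unfolding A_def B_def using n by (auto intro!: Liminf_bounded Limsup_bounded elim!: eventually_mono)
    have "A \<le> B" unfolding A_def B_def by (rule Liminf_le_Limsup) simp
    have "A = B"
    proof (rule ccontr)
      assume "A \<noteq> B"
      with \<open>A \<le> B\<close> have "A < B" by simp
      then obtain u where u: "A < ereal u" "ereal u < B" using ereal_dense2 by blast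
      then obtain v where v: "ereal u < ereal v" "ereal v < B" using ereal_dense2 by blast
      obtain r where r: "r \<in> \<rat>" "u < r" "r < v" using Rats_dense_in_real v(1) by (metis ereal_less_eq(3) not_less)
      obtain s where s: "s \<in> \<rat>" "r < s" "s < v" using Rats_dense_in_real r(3) by metis
      have "A < ereal r" using u(1) r(2) by (meson ereal_less_eq(3) less_imp_le less_le_trans)
      have "ereal s < B" using v(2) s(3) by (meson ereal_less_eq(3) less_imp_le le_less_trans)
      have "\<exists>\<^sub>F y in at x. Q x y < r"
      proof (rule ccontr)
        assume "\<not> ?thesis"
        then have "ereal r \<le> A"
          unfolding A_def by (intro Liminf_bounded) (auto simp: frequently_def not_less)
        with \<open>A < ereal r\<close> show False by simp
      qed
      moreover have "\<exists>\<^sub>F y in at x. s < Q x y"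
      proof (rule ccontr)
        assume "\<not> ?thesis"
        then have "B \<le> ereal s"
          unfolding B_def by (intro Limsup_bounded) (auto simp: frequently_def not_less)
        with \<open>ereal s < B\<close> show False by simp
      qed
      ultimately have "x \<in> E r s" using x by (simp add: E_def)
      then show False using nx r s by blast
    qed
    then obtain D where "A = ereal D" "B = ereal D" using bnd by (cases A) auto
    then have "((\<lambda>y. ereal (Q x y)) \<longlongrightarrow> ereal D) (at x)"
      by (intro Liminf_eq_Limsup) (auto simp: A_def B_def)
    then have "(g has_real_derivative D) (at x)"
      by (simp add: has_field_derivative_iff Q_def[abs_def])
    with x show False by (auto simp: real_differentiable_def)
  qed
  moreover have "countable {(r::real, s). r \<in> \<rat> \<and> s \<in> \<rat> \<and> r < s}"
    by (rule countable_subset[of _ "\<rat> \<times> \<rat>"]) (auto simp: countable_rat)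
  ultimately show ?thesis
    by (elim negligible_subset[rotated] ) (auto intro!: negligible_Un negligible_countable_Union)
qed

section \<open>Increments controlled by derivatives almost everywhere\<close>

text \<open>A gauge argument in the style of Henstock. On cells tagged outside \<open>N\<close>
  differentiability bounds the increment of \<open>u\<close> by that of \<open>v\<close> plus
  \<open>e\<close> times the length. Cells tagged in \<open>N\<close> lie in an open set of measure
  below \<open>d\<close>, so absolute continuity bounds their total contribution by
  \<open>e\<close>.\<close>

lemma abs_cont_on_increment_le:
  fixes u v :: "real \<Rightarrow> real"
  assumes "a \<le> b" and ac: "abs_cont_on a b u" and "negligible N"
    and mono: "\<And>x y. \<lbrakk>a \<le> x; x \<le> y; y \<le> b\<rbrakk> \<Longrightarrow> v x \<le> v y"
    and der: "\<And>x. x \<in> {a..b} - N \<Longrightarrow> \<exists>u' v'. (u has_real_derivative u') (at x) \<and>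
        (v has_real_derivative v') (at x) \<and> \<bar>u'\<bar> \<le> \<bar>v'\<bar>"
  shows "\<bar>u b - u a\<bar> \<le> v b - v a"
proof (rule field_le_epsilon)
  fix \<epsilon> :: real assume "\<epsilon> > 0"
  \<comment> \<open>The differentiability errors cost \<open>e * (b - a)\<close>, the cells tagged
    in \<open>N\<close> cost \<open>e\<close>; the summand 1 keeps the denominator positive when
    \<open>a = b\<close>.\<close>
  define e where "e = \<epsilon> / (b - a + 1)"
  have e: "e > 0" "e * (b - a) + e = \<epsilon>"
  proof -
    show "e > 0" using \<open>\<epsilon> > 0\<close> \<open>a \<le> b\<close> by (simp add: e_def)
    have "e * (b - a + 1) = \<epsilon>" using \<open>a \<le> b\<close> by (simp add: e_def)
    then show "e * (b - a) + e = \<epsilon>" by (simp add: algebra_simps)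
  qed
  obtain d where d: "d > 0"
    "\<And>(A :: (real \<times> real set) set) lo hi. \<lbrakk>finite A; \<And>i. i \<in> A \<Longrightarrow> a \<le> lo i \<and> lo i \<le> hi i \<and> hi i \<le> b;
       pairwise (\<lambda>i j. {lo i<..<hi i} \<inter> {lo j<..<hi j} = {}) A;
       (\<Sum>i\<in>A. hi i - lo i) < d\<rbrakk> \<Longrightarrow> (\<Sum>i\<in>A. \<bar>u (hi i) - u (lo i)\<bar>) < e"
    by (rule abs_cont_onD[OF ac \<open>e > 0\<close>]) blast
  obtain U where U: "open U" "N \<subseteq> U" "U \<in> lmeasurable" "measure lebesgue U < d"
  proof -
    have N: "N \<in> sets lebesgue" "N \<in> null_sets lebesgue"
      using \<open>negligible N\<close> by (auto simp: negligible_imp_sets negligible_iff_null_sets)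
    obtain T where T: "open T" "N \<subseteq> T" "T - N \<in> lmeasurable" "emeasure lebesgue (T - N) < ennreal d"
      using sets_lebesgue_outer_open[OF N(1) d(1)] by blast
    have "measure lebesgue (T - N) < d"
      using T(3,4) d(1) by (metis emeasure_eq_measure2 ennreal_less_iff measure_nonneg)
    moreover have "measure lebesgue ((T - N) \<union> N) = measure lebesgue (T - N)"
      using T(3) N(2) by (intro measure_Un_null_set) auto
    moreover have "(T - N) \<union> N \<in> lmeasurable"
      using T(3) \<open>negligible N\<close> by (intro fmeasurable.Un) (auto simp: negligible_imp_measurable)
    moreover have "(T - N) \<union> N = T" using T(2) by blast
    ultimately show thesis using T by (intro that[of T]) auto
  qed
  \<comment> \<open>The linearisations of \<open>u\<close> and \<open>v\<close> each contribute an
    error \<open>e2 * (r - l)\<close>.\<close>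
  define e2 where "e2 = e / 2"
  have e2: "e2 > 0" "e = e2 + e2" using e(1) by (auto simp: e2_def)
  \<comment> \<open>The tag lies between \<open>l\<close> and \<open>r\<close>, so the errors at the
    two ends, proportional to \<open>x - l\<close> and \<open>r - x\<close>, add up to a multiple of
    \<open>r - l\<close>.\<close>
  have near: "\<exists>\<eta>>0. \<forall>l r. l \<le> x \<and> x \<le> r \<and> \<bar>l - x\<bar> < \<eta> \<and> \<bar>r - x\<bar> < \<eta> \<longrightarrow>
      \<bar>u r - u l\<bar> \<le> \<bar>v r - v l\<bar> + e * (r - l)" if x: "x \<in> {a..b} - N" for x
  proof -
    obtain u' v' where D: "(u has_real_derivative u') (at x)" "(v has_real_derivative v') (at x)" "\<bar>u'\<bar> \<le> \<bar>v'\<bar>"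
      using der[OF x] by blast
    have lin: "\<exists>\<eta>>0. \<forall>y. \<bar>y - x\<bar> < \<eta> \<longrightarrow> \<bar>w y - w x - w' * (y - x)\<bar> \<le> e2 * \<bar>y - x\<bar>"
      if "(w has_real_derivative w') (at x)" for w w'
    proof -
      have "(w has_derivative (\<lambda>h. w' * h)) (at x)" using that by (simp add: has_field_derivative_def)
      then show ?thesis using e2(1) unfolding has_derivative_at_alt
        by (metis real_norm_def)
    qed
    obtain \<eta>1 where \<eta>1: "\<eta>1 > 0" "\<And>y. \<bar>y - x\<bar> < \<eta>1 \<Longrightarrow> \<bar>u y - u x - u' * (y - x)\<bar> \<le> e2 * \<bar>y - x\<bar>"
      using lin[OF D(1)] by blast
    obtain \<eta>2 where \<eta>2: "\<eta>2 > 0" "\<And>y. \<bar>y - x\<bar> < \<eta>2 \<Longrightarrow> \<bar>v y - v x - v' * (y - x)\<bar> \<le> e2 * \<bar>y - x\<bar>"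
      using lin[OF D(2)] by blast
    show ?thesis
    proof (intro exI[of _ "min \<eta>1 \<eta>2"] conjI allI impI)
      fix l r assume lr: "l \<le> x \<and> x \<le> r \<and> \<bar>l - x\<bar> < min \<eta>1 \<eta>2 \<and> \<bar>r - x\<bar> < min \<eta>1 \<eta>2"
      have "\<bar>u r - u l - u' * (r - l)\<bar> \<le> e2 * (r - l)"
      proof -
        have "\<bar>u r - u x - u' * (r - x)\<bar> \<le> e2 * (r - x)" "\<bar>u l - u x - u' * (l - x)\<bar> \<le> e2 * (x - l)"
          using \<eta>1(2)[of r] \<eta>1(2)[of l] lr by auto
        then show ?thesis by (auto simp: abs_le_iff algebra_simps)
      qed
      moreover have "\<bar>v r - v l - v' * (r - l)\<bar> \<le> e2 * (r - l)"
      proof -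
        have "\<bar>v r - v x - v' * (r - x)\<bar> \<le> e2 * (r - x)" "\<bar>v l - v x - v' * (l - x)\<bar> \<le> e2 * (x - l)"
          using \<eta>2(2)[of r] \<eta>2(2)[of l] lr by auto
        then show ?thesis by (auto simp: abs_le_iff algebra_simps)
      qed
      moreover have "\<bar>u' * (r - l)\<bar> \<le> \<bar>v' * (r - l)\<bar>"
        using D(3) by (simp add: abs_mult mult_right_mono)
      ultimately show "\<bar>u r - u l\<bar> \<le> \<bar>v r - v l\<bar> + e * (r - l)"
        unfolding e2(2) distrib_right by linarith
    qed (use \<eta>1 \<eta>2 in auto)
  qed
  \<comment> \<open>One gauge for all points: outside both \<open>N\<close> and
    \<open>{a..b}\<close> there is no constraint and the radius 1 is taken.\<close>
  have "\<exists>\<eta>>0. (x \<in> N \<longrightarrow> ball x \<eta> \<subseteq> U) \<and> (x \<in> {a..b} - N \<longrightarrow>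
      (\<forall>l r. l \<le> x \<and> x \<le> r \<and> \<bar>l - x\<bar> < \<eta> \<and> \<bar>r - x\<bar> < \<eta> \<longrightarrow> \<bar>u r - u l\<bar> \<le> \<bar>v r - v l\<bar> + e * (r - l)))" for x
  proof (cases "x \<in> N")
    case True
    then show ?thesis using U(1,2) by (meson DiffD2 openE subsetD)
  next
    case False
    then show ?thesis using near[of x] zero_less_one by blast
  qed
  then obtain \<eta> where \<eta>: "\<And>x. \<eta> x > 0" "\<And>x. x \<in> N \<Longrightarrow> ball x (\<eta> x) \<subseteq> U"
    "\<And>x l r. \<lbrakk>x \<in> {a..b} - N; l \<le> x; x \<le> r; \<bar>l - x\<bar> < \<eta> x; \<bar>r - x\<bar> < \<eta> x\<rbrakk> \<Longrightarrow>
       \<bar>u r - u l\<bar> \<le> \<bar>v r - v l\<bar> + e * (r - l)"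
    by metis
  obtain p where p: "p tagged_division_of {a..b}" "(\<lambda>x. ball x (\<eta> x)) fine p"
    using fine_division_exists_real[OF gauge_ball_dependent[of \<eta>]] \<eta>(1) by blast
  have fin: "finite p" using p(1) by (rule tagged_division_of_finite)
  have pK: "\<exists>l r. snd i = {l..r} \<and> l \<le> fst i \<and> fst i \<le> r \<and> a \<le> l \<and> r \<le> b \<and> {l..r} \<subseteq> ball (fst i) (\<eta> (fst i))"
    if ip: "i \<in> p" for i
  proof -
    obtain x K where i: "i = (x, K)" by (cases i)
    obtain l r where K: "K = {l..r}" using tagged_division_ofD(4)[OF p(1), of x K] ip i by auto
    have "x \<in> K" "K \<subseteq> {a..b}" using tagged_division_ofD(2,3)[OF p(1), of x K] ip i by auto
    moreover have "K \<subseteq> ball x (\<eta> x)" using fineD[OF p(2)] ip i by blast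
    ultimately show ?thesis using K i by auto
  qed
  define A where "A = {i\<in>p. fst i \<in> N}"
  define len where "len f i = f (Sup (snd i)) - f (Inf (snd i))" for f :: "real \<Rightarrow> real" and i :: "real \<times> real set"
  have tele: "(\<Sum>i\<in>p. len f i) = f b - f a" for f
    using additive_tagged_division_1[OF \<open>a \<le> b\<close> p(1), of f] by (simp add: len_def case_prod_beta)
  have fA: "finite A" "A \<subseteq> p" using fin by (auto simp: A_def)
  have Ap: "i \<in> p" if "i \<in> A" for i using that by (simp add: A_def)
  have nonneg: "len v i \<ge> 0" "len (\<lambda>x. x) i \<ge> 0" if "i \<in> p" for i
    using pK[OF that] mono by (force simp: len_def)+
  have disj: "pairwise (\<lambda>i j. interior (snd i) \<inter> interior (snd j) = {}) p"
    unfolding pairwise_def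
  proof (intro ballI impI)
    fix i j assume "i \<in> p" "j \<in> p" "i \<noteq> j"
    then show "interior (snd i) \<inter> interior (snd j) = {}"
      by (intro tagged_division_ofD(5)[OF p(1), of "fst i" _ "fst j"]) auto
  qed

  \<comment> \<open>Cells tagged in \<open>N\<close> lie in \<open>U\<close> and overlap only in
    null sets, so their lengths sum to at most the measure of \<open>U\<close>.\<close>
  have lenA: "(\<Sum>i\<in>A. len (\<lambda>x. x) i) < d"
  proof -
    have "(\<Sum>i\<in>A. len (\<lambda>x. x) i) = (\<Sum>i\<in>A. measure lebesgue (snd i))"
      using pK fA(2) by (intro sum.cong refl) (force simp: len_def)
    also have "\<dots> = measure lebesgue (\<Union>(snd ` A))"
    proof (rule measure_negligible_finite_Union_image[symmetric, OF fA(1)])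
      show "snd i \<in> lmeasurable" if "i \<in> A" for i using pK[OF Ap[OF that]] by auto
      show "pairwise (\<lambda>i j. negligible (snd i \<inter> snd j)) A"
        unfolding pairwise_def
      proof (intro ballI impI)
        fix i j assume ij: "i \<in> A" "j \<in> A" "i \<noteq> j"
        obtain l r l' r' where lr: "snd i = {l..r}" "snd j = {l'..r'}" using pK ij fA(2) by (meson subsetD)
        have "interior (snd i) \<inter> interior (snd j) = {}" using disj ij fA(2) unfolding pairwise_def by blast
        then have "interior (snd i \<inter> snd j) = {}" by simp
        moreover have "convex (snd i \<inter> snd j)" using lr by simp
        ultimately show "negligible (snd i \<inter> snd j)" using negligible_convex_interior by blast
      qed
    qed
    also have "\<dots> \<le> measure lebesgue U"
    proof (rule measure_mono_fmeasurable[OF _ _ U(3)])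
      show "\<Union>(snd ` A) \<subseteq> U" using pK \<eta>(2) by (fastforce simp: A_def)
      have "snd i \<in> sets lebesgue" if "i \<in> A" for i using pK[OF Ap[OF that]] by auto
      then show "\<Union>(snd ` A) \<in> sets lebesgue" using fA(1) by (intro sets.finite_Union) auto
    qed
    finally show ?thesis using U(4) by simp
  qed
  have "(\<Sum>i\<in>A. \<bar>len u i\<bar>) < e"
    unfolding len_def
  proof (rule d(2)[OF fA(1)])
    show "a \<le> Inf (snd i) \<and> Inf (snd i) \<le> Sup (snd i) \<and> Sup (snd i) \<le> b" if "i \<in> A" for i
      using pK[OF Ap[OF that]] by auto
    show "pairwise (\<lambda>i j. {Inf (snd i)<..<Sup (snd i)} \<inter> {Inf (snd j)<..<Sup (snd j)} = {}) A"
      unfolding pairwise_def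
    proof (intro ballI impI)
      fix i j assume ij: "i \<in> A" "j \<in> A" "i \<noteq> j"
      obtain l r where lr: "snd i = {l..r}" "l \<le> r" using pK[OF Ap[OF ij(1)]] by fastforce
      obtain l' r' where lr': "snd j = {l'..r'}" "l' \<le> r'" using pK[OF Ap[OF ij(2)]] by fastforce
      have "interior (snd i) \<inter> interior (snd j) = {}" using disj ij fA(2) unfolding pairwise_def by blast
      then show "{Inf (snd i)<..<Sup (snd i)} \<inter> {Inf (snd j)<..<Sup (snd j)} = {}"
        using lr lr' by simp
    qed
  qed (use lenA in \<open>simp add: len_def\<close>)
  moreover have "(\<Sum>i\<in>p - A. \<bar>len u i\<bar>) \<le> (\<Sum>i\<in>p - A. len v i + e * len (\<lambda>x. x) i)"
  proof (rule sum_mono)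
    fix i assume i: "i \<in> p - A"
    obtain l r where lr: "snd i = {l..r}" "l \<le> fst i" "fst i \<le> r" "a \<le> l" "r \<le> b"
      "{l..r} \<subseteq> ball (fst i) (\<eta> (fst i))" using pK[of i] i by blast
    have "l \<in> {l..r}" "r \<in> {l..r}" using lr by auto
    then have "l \<in> ball (fst i) (\<eta> (fst i))" "r \<in> ball (fst i) (\<eta> (fst i))" using lr(6) by blast+
    then have "\<bar>u r - u l\<bar> \<le> \<bar>v r - v l\<bar> + e * (r - l)"
      using i lr by (intro \<eta>(3)[of "fst i"]) (auto simp: dist_real_def A_def abs_minus_commute)
    moreover have "v l \<le> v r" using lr by (intro mono) auto
    ultimately show "\<bar>len u i\<bar> \<le> len v i + e * len (\<lambda>x. x) i" using lr by (simp add: len_def)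
  qed
  \<comment> \<open>The added terms are nonnegative because \<open>v\<close> is increasing; the full
    sum then telescopes.\<close>
  moreover have "(\<Sum>i\<in>p - A. len v i + e * len (\<lambda>x. x) i) \<le> (\<Sum>i\<in>p. len v i + e * len (\<lambda>x. x) i)"
    using nonneg e(1) fin by (intro sum_mono2) auto
  moreover have "(\<Sum>i\<in>p. len v i + e * len (\<lambda>x. x) i) = v b - v a + e * (b - a)"
    by (simp add: sum.distrib tele flip: sum_distrib_left)
  moreover have "\<bar>u b - u a\<bar> \<le> (\<Sum>i\<in>p. \<bar>len u i\<bar>)"
    unfolding tele[of u, symmetric] by (rule sum_abs)
  moreover have "(\<Sum>i\<in>p. \<bar>len u i\<bar>) = (\<Sum>i\<in>p - A. \<bar>len u i\<bar>) + (\<Sum>i\<in>A. \<bar>len u i\<bar>)"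
    using fA fin by (intro sum.subset_diff) auto
  ultimately show "\<bar>u b - u a\<bar> \<le> v b - v a + \<epsilon>" using e(2) by linarith
qed

subsection \<open>The Tauberian argument\<close>

lemma Ival_interval:
  assumes "x \<in> Ival T x0" "y \<in> Ival T x0" "x \<le> z" "z \<le> y"
  shows "z \<in> Ival T x0"
  using assms unfolding Ival_def by (auto intro: le_less_trans[of "ereal z" "ereal y"])

text \<open>At \<open>T\<close> the derivative within the interval is one-sided; beyond
  \<open>T\<close> it is the ordinary one, so the usual calculus rules apply there.\<close>

lemma at_within_Ival:
  assumes "x \<in> Ival T x0" "T < x"
  shows "at x within Ival T x0 = at x"
proof (rule at_within_open_subset)
  have "open {y. T < y}" "open {y. ereal y < x0}"
    by (intro open_Collect_less continuous_intros)+
  then show "open ({y. T < y} \<inter> {y. ereal y < x0})" by (rule open_Int)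
qed (use assms in \<open>auto simp: Ival_def\<close>)

text \<open>Treats finite and infinite \<open>x0\<close> alike, as a statement about a tail starting
  at \<open>c\<close>; the strict \<open>T < c\<close> keeps the tail where derivatives are
  two-sided.\<close>

lemma eventually_to_x0:
  assumes "ereal T < x0"
  shows "eventually P (to_x0 x0) \<longleftrightarrow> (\<exists>c\<in>Ival T x0. T < c \<and> (\<forall>x\<in>Ival T x0. c \<le> x \<longrightarrow> P x))"
proof (cases x0)
  case PInf
  show ?thesis
  proof
    assume "eventually P (to_x0 x0)"
    then obtain N where "\<And>x. x \<ge> N \<Longrightarrow> P x"
      using PInf by (auto simp: to_x0_def eventually_at_top_linorder)
    then show "\<exists>c\<in>Ival T x0. T < c \<and> (\<forall>x\<in>Ival T x0. c \<le> x \<longrightarrow> P x)"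
      using PInf by (intro bexI[of _ "max N (T + 1)"]) (auto simp: Ival_def)
  next
    assume "\<exists>c\<in>Ival T x0. T < c \<and> (\<forall>x\<in>Ival T x0. c \<le> x \<longrightarrow> P x)"
    then obtain c where "T < c" "\<forall>x\<in>Ival T x0. c \<le> x \<longrightarrow> P x" by blast
    then show "eventually P (to_x0 x0)"
      using PInf by (auto simp: to_x0_def eventually_at_top_linorder Ival_def intro!: exI[of _ c])
  qed
next
  case (real r)
  then have "T < r" using assms by simp
  show ?thesis
  proof
    assume "eventually P (to_x0 x0)"
    then obtain b where b: "b < r" "\<And>x. b < x \<Longrightarrow> x < r \<Longrightarrow> P x"
      using real \<open>T < r\<close> by (auto simp: to_x0_def eventually_at_left)
    obtain c where "max b T < c" "c < r" using dense[of "max b T" r] b(1) \<open>T < r\<close> by auto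
    then show "\<exists>c\<in>Ival T x0. T < c \<and> (\<forall>x\<in>Ival T x0. c \<le> x \<longrightarrow> P x)"
      using real b by (intro bexI[of _ c]) (auto simp: Ival_def)
  next
    assume "\<exists>c\<in>Ival T x0. T < c \<and> (\<forall>x\<in>Ival T x0. c \<le> x \<longrightarrow> P x)"
    then obtain c where "c < r" "T < c" "\<forall>x\<in>Ival T x0. c \<le> x \<longrightarrow> P x" 
      using real by (auto simp: Ival_def)
    then show "eventually P (to_x0 x0)"
      using real \<open>T < r\<close> by (auto simp: to_x0_def eventually_at_left Ival_def intro!: exI[of _ c])
  qed
qed (use assms in auto)

lemma has_real_derivative_dI:
  assumes "g differentiable (at x within Ival T x0)" "x \<in> Ival T x0" "T < x"
  shows "(g has_real_derivative dI (Ival T x0) g x) (at x)"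
  using assms
  by (simp add: dI_def at_within_Ival vector_derivative_works has_real_derivative_iff_has_vector_derivative)

lemma dI_eqI:
  assumes "(g has_real_derivative D) (at x)" "x \<in> Ival T x0" "T < x"
  shows "dI (Ival T x0) g x = D"
  using assms
  by (simp add: dI_def at_within_Ival vector_derivative_at has_real_derivative_iff_has_vector_derivative)

section \<open>The Tauberian lemma for a slowly varying function\<close>

text \<open>The natural variable is \<open>- ln \<bar>phi\<bar>\<close>, in which \<open>der\<close>
  says that \<open>w\<close> has slope at most \<open>C\<close> almost everywhere. Smallness of
  \<open>k\<close> forces \<open>w\<close> to be small at some point of every stretch, and the slope
  bound carries this to the start of the stretch.\<close>

lemma tendsto_zero_of_small_primitive:
  fixes phi phi' k w :: "real \<Rightarrow> real" and T :: real and x0 :: ereal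
  defines "I \<equiv> {x \<in> Ival T x0. T < x}"
  assumes T: "ereal T < x0" and "C \<ge> 0"
    and dphi: "\<And>x. x \<in> I \<Longrightarrow> (phi has_real_derivative phi' x) (at x)"
    and nz: "\<And>x. x \<in> I \<Longrightarrow> phi x \<noteq> 0 \<and> phi' x \<noteq> 0"
    and phi0: "(phi \<longlongrightarrow> 0) (to_x0 x0)"
    and dk: "\<And>x. x \<in> I \<Longrightarrow> (k has_real_derivative w x * phi' x) (at x)"
    and k_small: "k \<in> o[to_x0 x0](phi)"
    and ac: "\<And>a b. \<lbrakk>a \<in> I; b \<in> I; a \<le> b\<rbrakk> \<Longrightarrow> abs_cont_on a b w"
    and c: "c \<in> I"
    and der: "\<And>a b. \<lbrakk>c \<le> a; a \<le> b; b \<in> I\<rbrakk> \<Longrightarrow> \<exists>N. negligible N \<and>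
        (\<forall>x\<in>{a..b} - N. \<exists>w'. (w has_real_derivative w') (at x) \<and> \<bar>w'\<bar> \<le> C * \<bar>phi' x / phi x\<bar>)"
  shows "(w \<longlongrightarrow> 0) (to_x0 x0)"
proof -
  have mid: "z \<in> I" if "x \<in> I" "y \<in> I" "x \<le> z" "z \<le> y" for x y z
    using that Ival_interval[of x T x0 y z] by (auto simp: I_def)
  have dphi2: "((\<lambda>x. (phi x)\<^sup>2) has_real_derivative 2 * phi x * phi' x) (at x)" if "x \<in> I" for x
    using dphi[OF that] by (auto intro!: derivative_eq_intros)
  have reach: "\<exists>z\<in>I. y \<le> z \<and> \<bar>phi z\<bar> < s" if y: "y \<in> I" and "s > 0" for y s
  proof -
    have "\<forall>\<^sub>F x in to_x0 x0. \<bar>phi x\<bar> < s"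
      using tendstoD[OF phi0 \<open>s > 0\<close>] by (simp add: dist_real_def)
    then obtain c' where "c' \<in> I" "\<And>x. \<lbrakk>x \<in> I; c' \<le> x\<rbrakk> \<Longrightarrow> \<bar>phi x\<bar> < s"
      unfolding eventually_to_x0[OF T] by (auto simp: I_def)
    then show ?thesis using y by (intro bexI[of _ "max y c'"]) (auto simp: max_def)
  qed
  have cont: "isCont phi x" if "x \<in> I" for x using dphi[OF that] by (rule DERIV_isCont)

  \<comment> \<open>If the square failed to decrease from \<open>x\<close> to \<open>y\<close>,
    then, as \<open>phi\<close> tends to 0, it would return to its value at \<open>x\<close> at some
    \<open>t\<close> beyond \<open>x\<close>, and the mean value theorem would give a zero of
    \<open>phi * phi'\<close>. Squares avoid a case split on the sign of \<open>phi\<close>.\<close>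
  have decr: "(phi y)\<^sup>2 < (phi x)\<^sup>2" if xy: "x \<in> I" "y \<in> I" "x < y" for x y
  proof (rule ccontr)
    assume n: "\<not> (phi y)\<^sup>2 < (phi x)\<^sup>2"
    obtain z where z: "z \<in> I" "y \<le> z" "\<bar>phi z\<bar> < \<bar>phi x\<bar>"
      using reach[OF xy(2), of "\<bar>phi x\<bar>"] nz[OF xy(1)] by auto
    have "\<exists>t\<ge>y. t \<le> z \<and> (phi t)\<^sup>2 = (phi x)\<^sup>2"
    proof (rule IVT2)
      show "(phi z)\<^sup>2 \<le> (phi x)\<^sup>2" using z(3) by (simp add: abs_le_square_iff[symmetric])
      show "\<forall>t. y \<le> t \<and> t \<le> z \<longrightarrow> isCont (\<lambda>x. (phi x)\<^sup>2) t"
        using cont mid[OF xy(2) z(1)] by (auto intro!: continuous_intros)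
    qed (use n z in auto)
    then obtain t where t: "y \<le> t" "t \<le> z" "(phi t)\<^sup>2 = (phi x)\<^sup>2" by blast
    have tI: "t \<in> I" using mid[OF xy(2) z(1)] t by blast
    have "x < t" using xy(3) t(1) by simp
    then obtain s where s: "x < s" "s < t" "(phi t)\<^sup>2 - (phi x)\<^sup>2 = (t - x) * (2 * phi s * phi' s)"
      using MVT2[of x t "\<lambda>x. (phi x)\<^sup>2" "\<lambda>s. 2 * phi s * phi' s"] dphi2 mid[OF xy(1) tI] by blast
    have "s \<in> I" using mid[OF xy(1) tI] s by simp
    then show False using s t(3) \<open>x < t\<close> nz by simp
  qed

  show ?thesis
  proof (rule tendstoI)
    fix \<eta> :: real assume "\<eta> > 0"
    \<comment> \<open>Chosen so that \<open>w\<close> varies by less than \<open>\<eta> / 2\<close>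
      over a stretch; \<open>C + 1\<close> keeps the denominator positive when
      \<open>C = 0\<close>.\<close>
    define \<tau> where "\<tau> = \<eta> / (2 * (C + 1))"
    have \<tau>: "\<tau> > 0" "C * \<tau> < \<eta> / 2" using \<open>\<eta> > 0\<close> \<open>C \<ge> 0\<close> by (auto simp: \<tau>_def field_simps)
    \<comment> \<open>The fraction of \<open>\<bar>phi x\<bar>\<close> lost along the
      stretch.\<close>
    define \<delta> where "\<delta> = 1 - exp (- \<tau>)"
    have \<delta>: "\<delta> > 0" using \<tau> by (simp add: \<delta>_def)
    \<comment> \<open>The quarter is used at both ends of the stretch; dividing by
      \<open>\<delta> * \<bar>phi x\<bar>\<close> then leaves \<open>\<eta> / 2\<close> as the bound
      for \<open>w\<close> at the intermediate point.\<close>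
    have "\<forall>\<^sub>F x in to_x0 x0. norm (k x) \<le> (\<eta> * \<delta> / 4) * norm (phi x)"
      by (rule landau_o.smallD[OF k_small]) (use \<open>\<eta> > 0\<close> \<delta> in simp)
    then obtain c1 where c1: "c1 \<in> I" "\<And>x. \<lbrakk>x \<in> I; c1 \<le> x\<rbrakk> \<Longrightarrow> \<bar>k x\<bar> \<le> (\<eta> * \<delta> / 4) * \<bar>phi x\<bar>"
      unfolding eventually_to_x0[OF T] by (auto simp: I_def)
    have main: "\<bar>w x\<bar> < \<eta>" if x: "x \<in> I" "c \<le> x" "c1 \<le> x" for x
    proof -
      have px: "\<bar>phi x\<bar> > 0" using nz[OF x(1)] by simp
      obtain z where z: "z \<in> I" "x \<le> z" "\<bar>phi z\<bar> < exp (- \<tau>) * \<bar>phi x\<bar>"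
        using reach[OF x(1), of "exp (- \<tau>) * \<bar>phi x\<bar>"] px by auto
      have less: "exp (- \<tau>) * \<bar>phi x\<bar> < \<bar>phi x\<bar>" using px \<tau> by simp
      have "\<exists>y\<ge>x. y \<le> z \<and> \<bar>phi y\<bar> = exp (- \<tau>) * \<bar>phi x\<bar>"
      proof (rule IVT2)
        show "\<forall>t. x \<le> t \<and> t \<le> z \<longrightarrow> isCont (\<lambda>x. \<bar>phi x\<bar>) t"
          using cont mid[OF x(1) z(1)] by (auto intro!: continuous_intros)
      qed (use z less in auto)
      then obtain y where y: "x \<le> y" "y \<le> z" "\<bar>phi y\<bar> = exp (- \<tau>) * \<bar>phi x\<bar>" by blast
      have yI: "y \<in> I" using mid[OF x(1) z(1)] y by blast
      have "x < y" using y less by (cases "x = y") auto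
      have sub: "t \<in> I" if "x \<le> t" "t \<le> y" for t using mid[OF x(1) yI] that by blast
      \<comment> \<open>Cauchy's mean value theorem for \<open>k\<close> against \<open>phi\<close>;
        the nonzero factor \<open>phi' \<xi>\<close> cancels and isolates
        \<open>w \<xi>\<close>.\<close>
      have "\<exists>\<xi>>x. \<xi> < y \<and> (k y - k x) * phi' \<xi> = (phi y - phi x) * (w \<xi> * phi' \<xi>)"
      proof (rule GMVT'[OF \<open>x < y\<close>])
        show "isCont k t" if "x \<le> t" "t \<le> y" for t using DERIV_isCont[OF dk[OF sub]] that by blast
        show "isCont phi t" if "x \<le> t" "t \<le> y" for t using cont[OF sub] that by blast
      qed (use dk dphi sub in auto)
      then obtain \<xi> where \<xi>: "x < \<xi>" "\<xi> < y" "(k y - k x) * phi' \<xi> = (phi y - phi x) * (w \<xi> * phi' \<xi>)"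
        by blast
      have \<xi>I: "\<xi> \<in> I" using sub \<xi> by simp
      have eq: "k y - k x = (phi y - phi x) * w \<xi>" using \<xi>(3) nz[OF \<xi>I] by simp
      have "\<delta> * \<bar>phi x\<bar> = \<bar>phi x\<bar> - \<bar>phi y\<bar>" using y(3) by (simp add: \<delta>_def algebra_simps)
      also have "\<dots> \<le> \<bar>phi y - phi x\<bar>" by linarith
      finally have "\<delta> * \<bar>phi x\<bar> * \<bar>w \<xi>\<bar> \<le> \<bar>phi y - phi x\<bar> * \<bar>w \<xi>\<bar>"
        by (rule mult_right_mono) simp
      also have "\<dots> = \<bar>k y - k x\<bar>" by (simp add: eq abs_mult)
      also have "\<dots> \<le> \<bar>k y\<bar> + \<bar>k x\<bar>" by simp
      also have "\<dots> \<le> (\<eta> * \<delta> / 4) * \<bar>phi y\<bar> + (\<eta> * \<delta> / 4) * \<bar>phi x\<bar>"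
        using c1(2)[OF yI] c1(2)[OF x(1)] x(3) \<open>x < y\<close> by (intro add_mono) auto
      also have "\<dots> \<le> (\<eta> * \<delta> / 4) * \<bar>phi x\<bar> + (\<eta> * \<delta> / 4) * \<bar>phi x\<bar>"
        using y(3) less \<delta> \<open>\<eta> > 0\<close> by (intro add_mono mult_left_mono) auto
      also have "\<dots> = \<delta> * \<bar>phi x\<bar> * (\<eta> / 2)" by simp
      finally have w\<xi>: "\<bar>w \<xi>\<bar> \<le> \<eta> / 2" using \<delta> px by simp

      obtain N where N: "negligible N" "\<And>t. t \<in> {x..\<xi>} - N \<Longrightarrow>
          \<exists>w'. (w has_real_derivative w') (at t) \<and> \<bar>w'\<bar> \<le> C * \<bar>phi' t / phi t\<bar>"
        using der[OF x(2) less_imp_le[OF \<xi>(1)] \<xi>I] by blast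
      \<comment> \<open>This is \<open>- C * ln \<bar>phi t\<bar>\<close>, whose derivative has
        absolute value \<open>C * \<bar>phi' t / phi t\<bar>\<close>; \<open>decr\<close> makes it
        increasing.\<close>
      define v where "v t = - (C / 2) * ln ((phi t)\<^sup>2)" for t
      have pos: "(phi t)\<^sup>2 > 0" if "t \<in> I" for t using nz[OF that] by simp
      have "\<bar>w \<xi> - w x\<bar> \<le> v \<xi> - v x"
      proof (rule abs_cont_on_increment_le[OF less_imp_le[OF \<xi>(1)] ac[OF x(1) \<xi>I less_imp_le[OF \<xi>(1)]] N(1)])
        fix s t assume st: "x \<le> s" "s \<le> t" "t \<le> \<xi>"
        have "s \<in> I" "t \<in> I" using st \<xi> sub by auto
        then have "(phi t)\<^sup>2 \<le> (phi s)\<^sup>2" using decr[of s t] st by (cases "s = t") auto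
        then have "ln ((phi t)\<^sup>2) \<le> ln ((phi s)\<^sup>2)"
          using pos[OF \<open>t \<in> I\<close>] by (intro ln_mono) auto
        then show "v s \<le> v t" using \<open>C \<ge> 0\<close> by (simp add: v_def mult_left_mono)
      next
        fix t assume t: "t \<in> {x..\<xi>} - N"
        then have tI: "t \<in> I" using sub \<xi> by auto
        have "(v has_real_derivative - (C / 2) * (2 * phi t * phi' t / (phi t)\<^sup>2)) (at t)"
          unfolding v_def
          using DERIV_cmult[OF DERIV_chain2[OF DERIV_ln_divide[OF pos[OF tI]] dphi2[OF tI]], of "- (C / 2)"]
          by simp
        moreover have "\<bar>- (C / 2) * (2 * phi t * phi' t / (phi t)\<^sup>2)\<bar> = C * \<bar>phi' t / phi t\<bar>"
          using \<open>C \<ge> 0\<close> nz[OF tI] by (simp add: power2_eq_square abs_mult)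
        ultimately show "\<exists>u' v'. (w has_real_derivative u') (at t) \<and> (v has_real_derivative v') (at t) \<and> \<bar>u'\<bar> \<le> \<bar>v'\<bar>"
          using N(2)[OF t] by metis
      qed
      also have "\<dots> = (C / 2) * (ln ((phi x)\<^sup>2) - ln ((phi \<xi>)\<^sup>2))"
        by (simp add: v_def algebra_simps)
      \<comment> \<open>Moving from \<open>\<xi>\<close> on to \<open>y\<close> only increases the
        bound, and at \<open>y\<close> the shrinkage of \<open>\<bar>phi\<bar>\<close> is exactly
        \<open>exp (- \<tau>)\<close>.\<close>
      also have "\<dots> \<le> (C / 2) * (ln ((phi x)\<^sup>2) - ln ((phi y)\<^sup>2))"
        using decr[OF \<xi>I yI \<xi>(2)] pos[OF yI] pos[OF x(1)] \<open>C \<ge> 0\<close>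
        by (intro mult_left_mono diff_mono ln_mono) auto
      also have "ln ((phi y)\<^sup>2) = 2 * ln \<bar>phi y\<bar>"
        using ln_realpow[of "\<bar>phi y\<bar>" 2] nz[OF yI] by simp
      also have "\<dots> = 2 * (ln \<bar>phi x\<bar> - \<tau>)" unfolding y(3) using px by (simp add: ln_mult)
      also have "ln ((phi x)\<^sup>2) = 2 * ln \<bar>phi x\<bar>"
        using ln_realpow[of "\<bar>phi x\<bar>" 2] nz[OF x(1)] by simp
      finally have "\<bar>w \<xi> - w x\<bar> \<le> C * \<tau>" by (simp add: algebra_simps)
      then show ?thesis using w\<xi> \<tau>(2) by linarith
    qed
    show "\<forall>\<^sub>F x in to_x0 x0. dist (w x) 0 < \<eta>"
      unfolding eventually_to_x0[OF T]
      using c c1(1) main by (intro bexI[of _ "max c c1"]) (auto simp: I_def max_def)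
  qed
qed

section \<open>Wronskians and the operator \<open>Lop\<close>\<close>

text \<open>A continuous derivative is bounded on a compact interval, so \<open>g\<close> is
  Lipschitz there and its increments are dominated by those of the identity.\<close>

lemma C1_on_imp_abs_cont_on:
  assumes "C1_on (Ival T x0) g" and ab: "{a..b} \<subseteq> Ival T x0" and "T < a"
  shows "abs_cont_on a b g" "continuous_on {a..b} g" "continuous_on {a..b} (dI (Ival T x0) g)"
proof -
  have der: "(g has_real_derivative dI (Ival T x0) g x) (at x)" if "x \<in> {a..b}" for x
    using assms that by (intro has_real_derivative_dI) (auto simp: C1_on_def)
  show "continuous_on {a..b} g"
    using der DERIV_isCont continuous_at_imp_continuous_on by metis
  show cont: "continuous_on {a..b} (dI (Ival T x0) g)"
    using assms continuous_on_subset by (auto simp: C1_on_def)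
  have "bounded (dI (Ival T x0) g ` {a..b})"
    using cont by (intro compact_imp_bounded compact_continuous_image) auto
  then obtain M where M: "\<And>x. x \<in> {a..b} \<Longrightarrow> norm (dI (Ival T x0) g x) \<le> M"
    unfolding bounded_iff by (metis imageI)
  show "abs_cont_on a b g"
  proof (rule abs_cont_on_combine[OF abs_cont_on_id])
    fix x y assume "x \<in> {a..b}" "y \<in> {a..b}"
    then show "\<bar>g y - g x\<bar> \<le> M * \<bar>y - x\<bar>"
      using field_differentiable_bound[of "{a..b}" g "dI (Ival T x0) g" M y x] M der
      by (simp add: has_field_derivative_at_within)
  qed
qed

lemma abs_cont_on_wronskian:
  assumes "AC1_on (Ival T x0) g" "AC1_on (Ival T x0) h"
    and ab: "{a..b} \<subseteq> Ival T x0" "T < a" "a \<le> b"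
  shows "abs_cont_on a b (wronskian (Ival T x0) g h)" "continuous_on {a..b} (wronskian (Ival T x0) g h)"
proof -
  have g: "C1_on (Ival T x0) g" "abs_cont_on a b (dI (Ival T x0) g)"
    and h: "C1_on (Ival T x0) h" "abs_cont_on a b (dI (Ival T x0) h)"
    using assms by (auto simp: AC1_on_def)
  note g' = C1_on_imp_abs_cont_on[OF g(1) ab(1,2)] and h' = C1_on_imp_abs_cont_on[OF h(1) ab(1,2)]
  show "abs_cont_on a b (wronskian (Ival T x0) g h)"
    unfolding wronskian_def[abs_def]
    by (intro abs_cont_on_diff abs_cont_on_mult g h g' h')
  show "continuous_on {a..b} (wronskian (Ival T x0) g h)"
    unfolding wronskian_def[abs_def]
    by (intro continuous_intros g' h')
qed

lemma twice_diff_at_derivatives: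
  assumes "twice_diff_at (Ival T x0) g x" "T < x"
  shows "(g has_real_derivative dI (Ival T x0) g x) (at x)"
    "(dI (Ival T x0) g has_real_derivative d2I (Ival T x0) g x) (at x)"
proof -
  have "x \<in> Ival T x0" using assms by (simp add: twice_diff_at_def)
  then show "(g has_real_derivative dI (Ival T x0) g x) (at x)"
    using assms by (intro has_real_derivative_dI) (auto simp: twice_diff_at_def)
  have "(dI (Ival T x0) g has_real_derivative dI (Ival T x0) (dI (Ival T x0) g) x) (at x)"
    using assms by (intro has_real_derivative_dI) (auto simp: twice_diff_at_def)
  then show "(dI (Ival T x0) g has_real_derivative d2I (Ival T x0) g x) (at x)"
    by (simp add: dI_def[of _ "dI (Ival T x0) g"] d2I_def)
qed

text \<open>This is the factorised form of the operator: \<open>wronskian I p1 u / W\<close> equals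
  \<open>(p1^2 / W)\<close> times the derivative of \<open>u / p1\<close>, and differentiating it
  produces \<open>L[u]\<close> up to the factor \<open>p1 / W\<close>.\<close>

lemma wronskian_quotient_derivative:
  assumes "x \<in> Ldom (Ival T x0) p1 p2 u" "T < x" and W: "wronskian (Ival T x0) p1 p2 x \<noteq> 0"
  shows "((\<lambda>x. wronskian (Ival T x0) p1 u x / wronskian (Ival T x0) p1 p2 x) has_real_derivative
     p1 x / wronskian (Ival T x0) p1 p2 x * Lop (Ival T x0) p1 p2 u x) (at x)"
proof -
  let ?I = "Ival T x0"
  note D = twice_diff_at_derivatives[OF _ \<open>T < x\<close>]
  have tw: "twice_diff_at ?I u x" "twice_diff_at ?I p1 x" "twice_diff_at ?I p2 x"
    using assms(1) by (auto simp: Ldom_def)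
  define q0 q1 q2 r0 r1 r2 s0 s1 s2 where
    "q0 = p1 x" "q1 = dI ?I p1 x" "q2 = d2I ?I p1 x" "r0 = p2 x" "r1 = dI ?I p2 x" "r2 = d2I ?I p2 x"
    "s0 = u x" "s1 = dI ?I u x" "s2 = d2I ?I u x"
  note q_defs = this
  define V where "V = q0 * r1 - q1 * r0"
  have V: "V \<noteq> 0" "wronskian ?I p1 p2 x = V" using W by (auto simp: V_def q_defs wronskian_def)
  \<comment> \<open>The products of first derivatives cancel when a Wronskian is
    differentiated.\<close>
  have dN: "(wronskian ?I p1 u has_real_derivative q0 * s2 - q2 * s0) (at x)"
    unfolding wronskian_def[abs_def] q_defs
    by (rule derivative_eq_intros D tw refl | simp)+
  have dD: "(wronskian ?I p1 p2 has_real_derivative q0 * r2 - q2 * r0) (at x)"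
    unfolding wronskian_def[abs_def] q_defs
    by (rule derivative_eq_intros D tw refl | simp)+
  have N: "wronskian ?I p1 u x = q0 * s1 - q1 * s0" by (simp add: q_defs wronskian_def)
  have "((\<lambda>x. wronskian ?I p1 u x / wronskian ?I p1 p2 x) has_real_derivative
      ((q0 * s2 - q2 * s0) * V - (q0 * s1 - q1 * s0) * (q0 * r2 - q2 * r0)) / (V * V)) (at x)"
    using DERIV_divide[OF dN dD W] unfolding N V(2) .
  moreover have "((q0 * s2 - q2 * s0) * V - (q0 * s1 - q1 * s0) * (q0 * r2 - q2 * r0)) / (V * V)
      = q0 / V * (s2 + - (q0 * r2 - q2 * r0) / V * s1 + (q1 * r2 - q2 * r1) / V * s0)"
  proof -
    \<comment> \<open>Expanding \<open>V\<close>, the terms with \<open>q1 * q2 * r0 * s0\<close>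
      cancel, which lets \<open>q0\<close> be factored out.\<close>
    have "(q0 * s2 - q2 * s0) * V - (q0 * s1 - q1 * s0) * (q0 * r2 - q2 * r0)
      = q0 * (s2 * V - (q0 * r2 - q2 * r0) * s1 + (q1 * r2 - q2 * r1) * s0)"
      unfolding V_def by algebra
    also have "\<dots> = q0 * V * (s2 + - (q0 * r2 - q2 * r0) / V * s1 + (q1 * r2 - q2 * r1) / V * s0)"
      using V(1) by (simp add: field_simps)
    finally show ?thesis using V(1) by simp
  qed
  ultimately show ?thesis
    unfolding Lop_def Let_def V(2) q_defs by simp
qed

text \<open>The three first derivatives are absolutely continuous, hence differentiable off a null
  set of the open interval; the two endpoints are added to the exceptional set.\<close>

lemma Ldom_full_measure:
  assumes AC: "AC1_on (Ival T x0) p1" "AC1_on (Ival T x0) p2" "AC1_on (Ival T x0) u"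
    and ab: "{a..b} \<subseteq> Ival T x0" "T < a" "a \<le> b"
  shows "negligible ({a..b} - Ldom (Ival T x0) p1 p2 u)"
proof -
  let ?I = "Ival T x0"
  define E where "E g = {x\<in>{a<..<b}. \<not> dI ?I g differentiable (at x)}" for g
  have neg: "negligible (E g)" if "AC1_on ?I g" for g
    unfolding E_def using that ab
    by (intro abs_cont_on_negligible_not_differentiable) (auto simp: AC1_on_def)
  have tw: "twice_diff_at ?I g x" if "AC1_on ?I g" "x \<in> {a<..<b} - E g" for g x
  proof -
    have "x \<in> ?I" "T < x" using that(2) ab by auto
    then show ?thesis
      using that by (auto simp: twice_diff_at_def at_within_Ival E_def AC1_on_def C1_on_def)
  qed
  have "{a..b} - Ldom ?I p1 p2 u \<subseteq> E p1 \<union> E p2 \<union> E u \<union> {a, b}"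
  proof
    fix x assume x: "x \<in> {a..b} - Ldom ?I p1 p2 u"
    show "x \<in> E p1 \<union> E p2 \<union> E u \<union> {a, b}"
    proof (rule ccontr)
      assume n: "\<not> ?thesis"
      then have "x \<in> {a<..<b}" using x by auto
      then have "x \<in> Ldom ?I p1 p2 u" using n tw AC by (auto simp: Ldom_def)
      then show False using x by blast
    qed
  qed
  moreover have "negligible (E p1 \<union> E p2 \<union> E u \<union> {a, b})"
    using neg AC by (intro negligible_Un) (auto intro: negligible_finite)
  ultimately show ?thesis by (rule negligible_subset[rotated])
qed

section \<open>Application of the Tauberian lemma\<close>

text \<open>Instantiates the Tauberian lemma: the derivative of \<open>phi\<close> is
  \<open>W / p1^2\<close>, the Wronskian quotient gives \<open>w\<close>, and dividing the expansion
  of \<open>f\<close> by \<open>p1\<close> gives \<open>k\<close>, which is small against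
  \<open>phi\<close>.\<close>

lemma dI_quotient_small:
  fixes x0 :: ereal and T :: real and p1 p2 f :: "real \<Rightarrow> real" and a1 a2 :: real
  defines "I \<equiv> Ival T x0"
      and "F \<equiv> to_x0 x0"
      and "W \<equiv> wronskian (Ival T x0) p1 p2"
      and "phi \<equiv> (\<lambda>x. p2 x / p1 x)"
  assumes T_lt: "ereal T < x0"
      and AC1_p1: "AC1_on I p1" and AC1_p2: "AC1_on I p2"
      and p2_o_p1: "p2 \<in> o[F](p1)"
      and p1_nz: "\<forall>x\<in>I. p1 x \<noteq> 0" and p2_nz: "\<forall>x\<in>I. p2 x \<noteq> 0"
      and W_nz: "\<forall>x\<in>I. W x \<noteq> 0"
      and AC1_f: "AC1_on I f"
      and f_asymp: "(\<lambda>x. f x - a1 * p1 x - a2 * p2 x) \<in> o[F](p2)"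
      and L: "Lop I p1 p2 f \<in> O[inf F (principal (Ldom I p1 p2 f))](\<lambda>x. W x ^ 2 / (p1 x ^ 2 * p2 x))"
    shows "(\<lambda>x. dI I (\<lambda>y. f y / p1 y) x - a2 * dI I phi x) \<in> o[F](dI I phi)"
proof -
  note ev = eventually_to_x0[OF T_lt, folded I_def F_def]
  define phi' where "phi' x = W x / (p1 x)\<^sup>2" for x
  define w where "w x = wronskian I p1 f x / W x - a2" for x
  define k where "k x = f x / p1 x - a1 - a2 * phi x" for x
  define J where "J = {x \<in> I. T < x}"
  have J: "x \<in> I" "T < x" "p1 x \<noteq> 0" "p2 x \<noteq> 0" "W x \<noteq> 0" if "x \<in> J" for x
    using that p1_nz p2_nz W_nz by (auto simp: J_def)
  have der: "(g has_real_derivative dI I g x) (at x)" if "AC1_on I g" "x \<in> J" for g x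
    using that unfolding I_def
    by (intro has_real_derivative_dI) (auto simp: AC1_on_def C1_on_def J_def I_def)
  have quot: "((\<lambda>x. g x / p1 x) has_real_derivative wronskian I p1 g x / (p1 x)\<^sup>2) (at x)"
    if "AC1_on I g" "x \<in> J" for g x
    using der[OF AC1_p1 that(2)] der[OF that] J[OF that(2)]
    by (auto intro!: derivative_eq_intros simp: wronskian_def power2_eq_square)
  have dphi: "(phi has_real_derivative phi' x) (at x)" if "x \<in> J" for x
    using quot[OF AC1_p2 that] by (simp add: phi_def phi'_def W_def I_def)
  have dk: "(k has_real_derivative w x * phi' x) (at x)" if "x \<in> J" for x
  proof -
    have "(k has_real_derivative wronskian I p1 f x / (p1 x)\<^sup>2 - a2 * phi' x) (at x)"
      unfolding k_def[abs_def]
      using DERIV_diff[OF DERIV_diff[OF quot[OF AC1_f that] DERIV_const] DERIV_cmult[OF dphi[OF that]]]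
      by simp
    also have "wronskian I p1 f x / (p1 x)\<^sup>2 - a2 * phi' x = w x * phi' x"
      using J[OF that] by (simp add: w_def phi'_def field_simps)
    finally show ?thesis .
  qed
  have phi0: "(phi \<longlongrightarrow> 0) F"
  proof (rule tendstoI)
    fix e :: real assume "e > 0"
    then have "\<forall>\<^sub>F x in F. norm (p2 x) \<le> e / 2 * norm (p1 x)"
      by (intro landau_o.smallD[OF p2_o_p1]) simp
    then obtain c where c: "c \<in> I" "T < c" "\<And>x. x \<in> I \<Longrightarrow> c \<le> x \<Longrightarrow> \<bar>p2 x\<bar> \<le> e / 2 * \<bar>p1 x\<bar>"
      unfolding ev by auto
    have "\<bar>phi x\<bar> < e" if "x \<in> I" "c \<le> x" for x
    proof -
      have "\<bar>p1 x\<bar> > 0" using p1_nz that by simp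
      then have "\<bar>phi x\<bar> \<le> e / 2" using c(3)[OF that] by (simp add: phi_def abs_divide divide_le_eq)
      then show ?thesis using \<open>e > 0\<close> by simp
    qed
    then show "\<forall>\<^sub>F x in F. dist (phi x) 0 < e"
      unfolding ev using c(1,2) by auto
  qed
  have k_small: "k \<in> o[F](phi)"
  proof (rule landau_o.smallI)
    fix e :: real assume "e > 0"
    have "\<forall>\<^sub>F x in F. norm (f x - a1 * p1 x - a2 * p2 x) \<le> e * norm (p2 x)"
      by (rule landau_o.smallD[OF f_asymp \<open>e > 0\<close>])
    then obtain c where c: "c \<in> I" "T < c" "\<And>x. x \<in> I \<Longrightarrow> c \<le> x \<Longrightarrow> \<bar>f x - a1 * p1 x - a2 * p2 x\<bar> \<le> e * \<bar>p2 x\<bar>"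
      unfolding ev by auto
    have "\<bar>k x\<bar> \<le> e * \<bar>phi x\<bar>" if "x \<in> I" "c \<le> x" for x
    proof -
      have p: "p1 x \<noteq> 0" using p1_nz that by simp
      then have "k x = (f x - a1 * p1 x - a2 * p2 x) / p1 x" by (simp add: k_def phi_def diff_divide_distrib)
      then show ?thesis using c(3)[OF that] p by (simp add: phi_def abs_divide divide_right_mono)
    qed
    then show "\<forall>\<^sub>F x in F. norm (k x) \<le> e * norm (phi x)"
      unfolding ev using c(1,2) by auto
  qed
  have sub: "{a..b} \<subseteq> I" "T < a" if "a \<in> J" "b \<in> J" for a b
    using that Ival_interval[of a T x0 b] by (auto simp: J_def I_def)
  have ac: "abs_cont_on a b w" if ab: "a \<in> J" "b \<in> J" "a \<le> b" for a b
  proof -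
    note s = sub[OF ab(1,2), unfolded I_def]
    note N = abs_cont_on_wronskian[OF AC1_p1[unfolded I_def] AC1_f[unfolded I_def] s ab(3)]
      and D = abs_cont_on_wronskian[OF AC1_p1[unfolded I_def] AC1_p2[unfolded I_def] s ab(3), folded W_def]
    have nz: "W x \<noteq> 0" if "x \<in> {a..b}" for x using W_nz sub[OF ab(1,2)] that by blast
    \<comment> \<open>\<open>w\<close> differs from this product by the constant \<open>a2\<close>,
      so the increments agree and \<open>M = 1\<close> suffices below.\<close>
    have "abs_cont_on a b (\<lambda>x. wronskian I p1 f x * inverse (W x))"
      unfolding I_def
      by (intro abs_cont_on_mult N abs_cont_on_inverse D nz continuous_on_inverse) (use nz in auto)
    then show ?thesis
      by (rule abs_cont_on_combine[where M = 1]) (simp add: w_def divide_inverse)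
  qed
  obtain C where C: "C > 0"
    "\<forall>\<^sub>F x in inf F (principal (Ldom I p1 p2 f)). norm (Lop I p1 p2 f x) \<le> C * norm (W x ^ 2 / (p1 x ^ 2 * p2 x))"
    using landau_o.bigE[OF L] by blast
  then obtain c where c: "c \<in> I" "T < c" "\<And>x. \<lbrakk>x \<in> I; c \<le> x; x \<in> Ldom I p1 p2 f\<rbrakk> \<Longrightarrow>
      \<bar>Lop I p1 p2 f x\<bar> \<le> C * \<bar>W x ^ 2 / (p1 x ^ 2 * p2 x)\<bar>"
    unfolding eventually_inf_principal ev by auto
  have "(w \<longlongrightarrow> 0) F"
  proof (rule tendsto_zero_of_small_primitive[where C = C and phi = phi and phi' = phi' and k = k and c = c, OF T_lt,
        folded I_def F_def, folded J_def])
    show "phi x \<noteq> 0 \<and> phi' x \<noteq> 0" if "x \<in> J" for x using J[OF that] by (simp add: phi_def phi'_def)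
    show "c \<in> J" using c by (simp add: J_def)
    fix a b assume ab: "c \<le> a" "a \<le> b" "b \<in> J"
    have "a \<in> J" using ab c Ival_interval[of c T x0 b a] by (auto simp: J_def I_def)
    have "\<exists>w'. (w has_real_derivative w') (at x) \<and> \<bar>w'\<bar> \<le> C * \<bar>phi' x / phi x\<bar>"
      \<comment> \<open>The exceptional set is the part of \<open>{a..b}\<close> where
        \<open>Lop\<close> is not defined.\<close>
      if x: "x \<in> {a..b} - ({a..b} - Ldom I p1 p2 f)" for x
    proof (intro exI conjI)
      have x: "x \<in> Ldom I p1 p2 f" "x \<in> J" "c \<le> x"
        using x sub[OF \<open>a \<in> J\<close> ab(3)] ab(1) by (auto simp: J_def)
      show "(w has_real_derivative p1 x / W x * Lop I p1 p2 f x) (at x)"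
        using DERIV_diff[OF wronskian_quotient_derivative[of x T x0 p1 p2 f] DERIV_const] x(1) J[OF x(2)]
        unfolding w_def[abs_def] W_def I_def by simp
      have "\<bar>p1 x / W x * Lop I p1 p2 f x\<bar> \<le> \<bar>p1 x / W x\<bar> * (C * \<bar>W x ^ 2 / (p1 x ^ 2 * p2 x)\<bar>)"
        unfolding abs_mult using c(3)[OF J(1)[OF x(2)] x(3,1)] by (intro mult_left_mono) auto
      also have "\<dots> = C * \<bar>(p1 x / W x) * (W x ^ 2 / (p1 x ^ 2 * p2 x))\<bar>"
        by (simp only: abs_mult mult.left_commute)
      \<comment> \<open>Here the weight in the hypothesis on \<open>L[f]\<close> shows its meaning:
        times \<open>p1 / W\<close> it is the logarithmic derivative of \<open>phi\<close>.\<close>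
      also have "(p1 x / W x) * (W x ^ 2 / (p1 x ^ 2 * p2 x)) = phi' x / phi x"
        using J[OF x(2)] by (simp add: phi'_def phi_def field_simps power2_eq_square)
      finally show "\<bar>p1 x / W x * Lop I p1 p2 f x\<bar> \<le> C * \<bar>phi' x / phi x\<bar>" .
    qed
    moreover have "negligible ({a..b} - Ldom I p1 p2 f)"
      using Ldom_full_measure[of T x0 p1 p2 f a b] AC1_p1 AC1_p2 AC1_f sub[OF \<open>a \<in> J\<close> ab(3)] ab(2)
      by (simp add: I_def)
    ultimately show "\<exists>N. negligible N \<and>
        (\<forall>x\<in>{a..b} - N. \<exists>w'. (w has_real_derivative w') (at x) \<and> \<bar>w'\<bar> \<le> C * \<bar>phi' x / phi x\<bar>)"
      by blast
  qed (use C(1) dphi dk phi0 k_small ac in auto)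
  show ?thesis
  proof (rule landau_o.smallI)
    fix e :: real assume "e > 0"
    have "\<forall>\<^sub>F x in F. \<bar>w x\<bar> < e" using tendstoD[OF \<open>(w \<longlongrightarrow> 0) F\<close> \<open>e > 0\<close>] by (simp add: dist_real_def)
    then obtain c where c: "c \<in> I" "T < c" "\<And>x. x \<in> I \<Longrightarrow> c \<le> x \<Longrightarrow> \<bar>w x\<bar> < e"
      unfolding ev by auto
    \<comment> \<open>Beyond \<open>T\<close> the difference to be estimated equals
      \<open>w x * phi' x\<close>, so the smallness of \<open>w\<close> is exactly the claimed
      relation.\<close>
    have "norm (dI I (\<lambda>y. f y / p1 y) x - a2 * dI I phi x) \<le> e * norm (dI I phi x)" if x: "x \<in> I" "c \<le> x" for x
    proof -
      have xJ: "x \<in> J" using x c(2) by (simp add: J_def)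
      have "dI I phi x = phi' x" using dI_eqI dphi[OF xJ] J(1,2)[OF xJ] unfolding I_def by blast
      moreover have "dI I (\<lambda>y. f y / p1 y) x = wronskian I p1 f x / (p1 x)\<^sup>2"
        using dI_eqI quot[OF AC1_f xJ] J(1,2)[OF xJ] unfolding I_def by blast
      moreover have "wronskian I p1 f x / (p1 x)\<^sup>2 - a2 * phi' x = w x * phi' x"
        using J[OF xJ] by (simp add: w_def phi'_def field_simps)
      ultimately show ?thesis
        using mult_right_mono[OF less_imp_le[OF c(3)[OF x]], of "\<bar>phi' x\<bar>"] by (simp add: abs_mult)
    qed
    then show "\<forall>\<^sub>F x in F. norm (dI I (\<lambda>y. f y / p1 y) x - a2 * dI I phi x) \<le> e * norm (dI I phi x)"
      unfolding ev using c(1,2) by blast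
  qed
qed

theorem theorem9p1:
  fixes x0 :: ereal and T :: real and p1 p2 f :: "real \<Rightarrow> real" and a1 a2 :: real
  defines "I \<equiv> Ival T x0"
      and "F \<equiv> to_x0 x0"
      and "W \<equiv> wronskian (Ival T x0) p1 p2"
      and "phi \<equiv> (\<lambda>x. p2 x / p1 x)"
  assumes T_lt: "ereal T < x0"
      and AC1_p1: "AC1_on I p1" and AC1_p2: "AC1_on I p2"
      and p2_o_p1: "p2 \<in> o[F](p1)"
      and p1_nz: "\<forall>x\<in>I. p1 x \<noteq> 0" and p2_nz: "\<forall>x\<in>I. p2 x \<noteq> 0"
      and W_nz: "\<forall>x\<in>I. W x \<noteq> 0"
      and AC1_f: "AC1_on I f"
      and f_asymp: "(\<lambda>x. f x - a1 * p1 x - a2 * p2 x) \<in> o[F](p2)"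
  shows
   "(Lop I p1 p2 f \<in> o[inf F (principal (Ldom I p1 p2 f))](\<lambda>x. W x ^ 2 / (p1 x ^ 2 * p2 x))
       \<longrightarrow> (\<lambda>x. dI I (\<lambda>y. f y / p1 y) x - a2 * dI I phi x) \<in> o[F](dI I phi))
    \<and>
    (Lop I p1 p2 f \<in> O[inf F (principal (Ldom I p1 p2 f))](\<lambda>x. W x ^ 2 / (p1 x ^ 2 * p2 x))
       \<longrightarrow> (dI I (\<lambda>y. f y / p1 y) \<in> O[F](dI I phi)
            \<and> (((eventually (\<lambda>x. dI I phi x > 0) F) \<or> (eventually (\<lambda>x. dI I phi x < 0) F))
                \<and> ((x0 \<noteq> \<infinity>
                     \<and> (\<lambda>x. (x - real_of_ereal x0) * dI I phi x) \<in> \<Theta>[F](phi)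
                     \<and> (\<lambda>x. (x - real_of_ereal x0) * d2I I phi x)
                         \<in> \<Theta>[inf F (principal {x. twice_diff_at I phi x})](dI I phi))
                   \<or> (x0 = \<infinity>
                     \<and> (\<lambda>x. x * dI I phi x) \<in> \<Theta>[F](phi)
                     \<and> (\<lambda>x. x * d2I I phi x)
                         \<in> \<Theta>[inf F (principal {x. twice_diff_at I phi x})](dI I phi)))
               \<longrightarrow> (\<lambda>x. dI I (\<lambda>y. f y / p1 y) x - a2 * dI I phi x) \<in> o[F](dI I phi))))"
proof -
  note assms' = T_lt AC1_p1 AC1_p2 p2_o_p1 p1_nz p2_nz W_nz AC1_f f_asymp
  note main = dI_quotient_small[OF assms'[unfolded I_def F_def W_def], folded I_def F_def W_def phi_def]
  \<comment> \<open>Adding back \<open>a2 * dI I phi x\<close>, itself bounded by a multiple of the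
    derivative of \<open>phi\<close>, turns the o-relation into the O-relation.\<close>
  have big: "dI I (\<lambda>y. f y / p1 y) \<in> O[F](dI I phi)"
    if "(\<lambda>x. dI I (\<lambda>y. f y / p1 y) x - a2 * dI I phi x) \<in> o[F](dI I phi)"
  proof -
    have "(\<lambda>x. (dI I (\<lambda>y. f y / p1 y) x - a2 * dI I phi x) + a2 * dI I phi x) \<in> O[F](dI I phi)"
      by (intro sum_in_bigo landau_o.small_imp_big[OF that] landau_o.big.cmult_in_iff') simp
    then show ?thesis by simp
  qed
  show ?thesis
    \<comment> \<open>\<open>main\<close> takes an O-bound on \<open>L[f]\<close>; part (I) enters
      it by weakening o to O, and the first claim of part (II) leaves it through
      \<open>big\<close>.\<close>
    using main big landau_o.small_imp_big by blast
qed

end
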